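(* Let $\Gamma$ be a finite simplicial graph that is triangle-free, i.e. has no three pairwise adjacent vertices. Then the Vietoris--Rips complex $\mathcal{VR}_2(A_\Gamma)$ of the right-angled Artin group $A_\Gamma$, using the standard word metric, is contractible.
   Context: For a finite simplicial graph $\Gamma$ (no loops or multiple edges) with vertex set $V(\Gamma)$ and edge set $E(\Gamma)$, the right-angled Artin group is $A_\Gamma=\langle V(\Gamma)\mid vw=wv\text{ for all }\{v,w\}\in E(\Gamma)\rangle$. The standard word metric $d$ on $A_\Gamma$ is the word metric with respect to the generating set $V(\Gamma)$: $d(g,h)$ is the word length of $g^{-1}h$. For $t\in\mathbb{R}$, $\mathcal{VR}_t(A_\Gamma)$ is the geometric realization of the poset (under inclusion) of all non-empty finite subsets $S\subseteq A_\Gamma$ with $d(g,g')\le t$ for all $g,g'\in S$, i.e. the simplicial complex whose simplices are the finite chains in this poset (the barycentric subdivision of the usual Vietoris--Rips complex). *)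

theory Defs
  imports "HOL-Analysis.Analysis" "HOL-Algebra.Generated_Groups"
begin

section \<open>Graphs\<close>

definition simplicial_graph :: "'a set \<Rightarrow> 'a set set \<Rightarrow> bool" where
  "simplicial_graph V E \<longleftrightarrow> (\<forall>e\<in>E. e \<subseteq> V \<and> card e = 2)"

definition triangle_free :: "'a set \<Rightarrow> 'a set set \<Rightarrow> bool" where
  "triangle_free V E \<longleftrightarrow>
     \<not> (\<exists>u\<in>V. \<exists>v\<in>V. \<exists>w\<in>V. {u, v} \<in> E \<and> {v, w} \<in> E \<and> {u, w} \<in> E)"


section \<open>Group presentations\<close>

text \<open>
  The letter \<open>(x, True)\<close> stands for the generator \<open>x\<close>, and \<open>(x, False)\<close> for its formal inverse.
  A pair \<open>(u, v)\<close> of words is read as the relation \<open>u = v\<close>.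
\<close>

type_synonym 'a gword = "('a \<times> bool) list"

definition gwords :: "'a set \<Rightarrow> 'a gword set" where
  "gwords S = lists (S \<times> UNIV)"

inductive_set pres_cong :: "'a set \<Rightarrow> ('a gword \<times> 'a gword) set \<Rightarrow> ('a gword \<times> 'a gword) set"
  for S R where
  refl: "u \<in> gwords S \<Longrightarrow> (u, u) \<in> pres_cong S R"
| sym: "(u, v) \<in> pres_cong S R \<Longrightarrow> (v, u) \<in> pres_cong S R"
| trans: "(u, v) \<in> pres_cong S R \<Longrightarrow> (v, w) \<in> pres_cong S R \<Longrightarrow> (u, w) \<in> pres_cong S R"
| mult: "(u, u') \<in> pres_cong S R \<Longrightarrow> (v, v') \<in> pres_cong S R \<Longrightarrow> (u @ v, u' @ v') \<in> pres_cong S R"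
| cancel: "x \<in> S \<Longrightarrow> ([(x, b), (x, \<not> b)], []) \<in> pres_cong S R"
| rel: "(u, v) \<in> R \<Longrightarrow> u \<in> gwords S \<Longrightarrow> v \<in> gwords S \<Longrightarrow> (u, v) \<in> pres_cong S R"

definition presented_group ::
    "'a set \<Rightarrow> ('a gword \<times> 'a gword) set \<Rightarrow> 'a gword set monoid" where
  "presented_group S R =
     \<lparr>carrier = gwords S // pres_cong S R,
      mult = (\<lambda>A B. \<Union>u\<in>A. \<Union>v\<in>B. pres_cong S R `` {u @ v}),
      one = pres_cong S R `` {[]}\<rparr>"

definition presented_gens ::
    "'a set \<Rightarrow> ('a gword \<times> 'a gword) set \<Rightarrow> 'a gword set set" where
  "presented_gens S R = (\<lambda>x. pres_cong S R `` {[(x, True)]}) ` S"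

lemma pres_cong_gwords:
  assumes "(u, v) \<in> pres_cong S R"
  shows "u \<in> gwords S \<and> v \<in> gwords S"
  using assms by induction (auto simp: gwords_def)

lemma equiv_pres_cong: "equiv (gwords S) (pres_cong S R)"
proof (rule equivI)
  show "pres_cong S R \<subseteq> gwords S \<times> gwords S"
    using pres_cong_gwords by fast
  show "refl_on (gwords S) (pres_cong S R)"
    by (rule refl_onI) (rule pres_cong.refl)
  show "sym (pres_cong S R)"
    by (rule symI) (rule pres_cong.sym)
  show "trans (pres_cong S R)"
    by (rule transI) (rule pres_cong.trans)
qed

lemma pres_class_mult:
  assumes "u \<in> gwords S" "v \<in> gwords S"
  shows "pres_cong S R `` {u} \<otimes>\<^bsub>presented_group S R\<^esub> pres_cong S R `` {v}
           = pres_cong S R `` {u @ v}"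
proof -
  have "(\<Union>a\<in>pres_cong S R `` {u}. \<Union>b\<in>pres_cong S R `` {v}. pres_cong S R `` {a @ b})
          = pres_cong S R `` {u @ v}"
    (is "?L = _")
  proof (intro equalityI subsetI)
    fix w assume "w \<in> ?L"
    then show "w \<in> pres_cong S R `` {u @ v}"
      by (auto intro: pres_cong.trans[OF pres_cong.mult])
  next
    fix w assume "w \<in> pres_cong S R `` {u @ v}"
    then show "w \<in> ?L"
      using assms by (auto intro: pres_cong.refl)
  qed
  then show ?thesis by (simp add: presented_group_def)
qed

lemma presented_carrierE:
  assumes "A \<in> carrier (presented_group S R)"
  obtains u where "u \<in> gwords S" "A = pres_cong S R `` {u}"
  using assms by (auto simp: presented_group_def elim: quotientE)

lemma pres_class_carrier:
  "u \<in> gwords S \<Longrightarrow> pres_cong S R `` {u} \<in> carrier (presented_group S R)"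
  by (auto simp: presented_group_def intro: quotientI)

lemma presented_one: "\<one>\<^bsub>presented_group S R\<^esub> = pres_cong S R `` {[]}"
  by (simp add: presented_group_def)

definition gword_inv :: "'a gword \<Rightarrow> 'a gword" where
  "gword_inv u = rev (map (\<lambda>(x, b). (x, \<not> b)) u)"

lemma gword_inv_gwords: "u \<in> gwords S \<Longrightarrow> gword_inv u \<in> gwords S"
  by (auto simp: gword_inv_def gwords_def)

lemma gword_inv_cong:
  "u \<in> gwords S \<Longrightarrow> (gword_inv u @ u, []) \<in> pres_cong S R"
proof (induction u)
  case Nil
  then show ?case by (simp add: gword_inv_def pres_cong.refl)
next
  case (Cons p u)
  obtain x b where p: "p = (x, b)" by fastforce
  have u: "u \<in> gwords S" and x: "x \<in> S"
    using Cons.prems by (auto simp: gwords_def p)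
  have "([(x, \<not> b), (x, b)], []) \<in> pres_cong S R"
    using pres_cong.cancel[where R = R and b = "\<not> b", OF x] by simp
  then have "([(x, \<not> b), (x, b)] @ u, [] @ u) \<in> pres_cong S R"
    by (rule pres_cong.mult[OF _ pres_cong.refl[OF u]])
  then have "(gword_inv u @ ([(x, \<not> b), (x, b)] @ u), gword_inv u @ ([] @ u)) \<in> pres_cong S R"
    by (rule pres_cong.mult[OF pres_cong.refl[OF gword_inv_gwords[OF u]]])
  then have "(gword_inv (p # u) @ (p # u), gword_inv u @ u) \<in> pres_cong S R"
    by (simp add: gword_inv_def p)
  then show ?case using Cons.IH[OF u] by (rule pres_cong.trans)
qed

lemma group_presented_group: "group (presented_group S R)"
proof (rule groupI)
  have nil: "[] \<in> gwords S" and app: "u \<in> gwords S \<Longrightarrow> v \<in> gwords S \<Longrightarrow> u @ v \<in> gwords S" for u v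
    by (auto simp: gwords_def)
  show "\<one>\<^bsub>presented_group S R\<^esub> \<in> carrier (presented_group S R)"
    unfolding presented_one by (rule pres_class_carrier[OF nil])
  fix A assume "A \<in> carrier (presented_group S R)"
  then obtain u where u: "u \<in> gwords S" "A = pres_cong S R `` {u}"
    by (rule presented_carrierE)
  show "\<one>\<^bsub>presented_group S R\<^esub> \<otimes>\<^bsub>presented_group S R\<^esub> A = A"
    unfolding presented_one u(2) by (simp add: pres_class_mult nil u(1))
  have "pres_cong S R `` {gword_inv u} \<otimes>\<^bsub>presented_group S R\<^esub> A = \<one>\<^bsub>presented_group S R\<^esub>"
    unfolding presented_one u(2) pres_class_mult[OF gword_inv_gwords[OF u(1)] u(1)]
    by (rule equiv_class_eq[OF equiv_pres_cong gword_inv_cong[OF u(1)]])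
  then show "\<exists>B\<in>carrier (presented_group S R).
      B \<otimes>\<^bsub>presented_group S R\<^esub> A = \<one>\<^bsub>presented_group S R\<^esub>"
    using pres_class_carrier[OF gword_inv_gwords[OF u(1)]] by blast
  fix B assume "B \<in> carrier (presented_group S R)"
  then obtain v where v: "v \<in> gwords S" "B = pres_cong S R `` {v}"
    by (rule presented_carrierE)
  show "A \<otimes>\<^bsub>presented_group S R\<^esub> B \<in> carrier (presented_group S R)"
    unfolding u(2) v(2) pres_class_mult[OF u(1) v(1)]
    by (rule pres_class_carrier[OF app[OF u(1) v(1)]])
  fix C assume "C \<in> carrier (presented_group S R)"
  then obtain w where w: "w \<in> gwords S" "C = pres_cong S R `` {w}"
    by (rule presented_carrierE)
  show "A \<otimes>\<^bsub>presented_group S R\<^esub> B \<otimes>\<^bsub>presented_group S R\<^esub> C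
      = A \<otimes>\<^bsub>presented_group S R\<^esub> (B \<otimes>\<^bsub>presented_group S R\<^esub> C)"
    unfolding u(2) v(2) w(2) by (simp add: pres_class_mult u(1) v(1) w(1) app)
qed


section \<open>Right-angled Artin groups\<close>

definition raag_relations :: "'a set set \<Rightarrow> ('a gword \<times> 'a gword) set" where
  "raag_relations E =
     {([(v, True), (w, True)], [(w, True), (v, True)]) | v w. {v, w} \<in> E}"

definition raag :: "'a set \<Rightarrow> 'a set set \<Rightarrow> 'a gword set monoid" where
  "raag V E = presented_group V (raag_relations E)"

definition raag_gens :: "'a set \<Rightarrow> 'a set set \<Rightarrow> 'a gword set set" where
  "raag_gens V E = presented_gens V (raag_relations E)"


section \<open>Word metrics\<close>

text \<open>Meaningful only for \<open>g\<close> in the subgroup generated by \<open>S\<close>; otherwise the \<open>LEAST\<close> is unspecified.\<close>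

definition word_length :: "('g, 'b) monoid_scheme \<Rightarrow> 'g set \<Rightarrow> 'g \<Rightarrow> nat" where
  "word_length G S g =
     (LEAST n. \<exists>xs. set xs \<subseteq> S \<union> m_inv G ` S \<and> length xs = n \<and> foldr (mult G) xs (one G) = g)"

definition word_metric :: "('g, 'b) monoid_scheme \<Rightarrow> 'g set \<Rightarrow> 'g \<Rightarrow> 'g \<Rightarrow> real" where
  "word_metric G S g h = real (word_length G S (inv\<^bsub>G\<^esub> g \<otimes>\<^bsub>G\<^esub> h))"

lemma presented_group_generated:
  assumes "g \<in> carrier (presented_group S R)"
  shows "\<exists>xs. set xs \<subseteq> presented_gens S R \<union> m_inv (presented_group S R) ` presented_gens S R
          \<and> foldr (mult (presented_group S R)) xs (one (presented_group S R)) = g"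
proof -
  let ?G = "presented_group S R"
  let ?X = "presented_gens S R \<union> m_inv ?G ` presented_gens S R"
  interpret group ?G by (rule group_presented_group)
  have letter: "pres_cong S R `` {[(x, b)]} \<in> ?X" if "x \<in> S" for x b
  proof (cases b)
    case True
    then show ?thesis using that by (auto simp: presented_gens_def)
  next
    case False
    have l: "[(x, c)] \<in> gwords S" for c using that by (simp add: gwords_def)
    have "pres_cong S R `` {[(x, False)]} \<otimes>\<^bsub>?G\<^esub> pres_cong S R `` {[(x, True)]} = \<one>\<^bsub>?G\<^esub>"
      using equiv_class_eq[OF equiv_pres_cong pres_cong.cancel[OF that, of False R]]
      by (simp add: pres_class_mult l presented_one)
    then have "inv\<^bsub>?G\<^esub> (pres_cong S R `` {[(x, True)]}) = pres_cong S R `` {[(x, False)]}"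
      by (rule inv_equality) (intro pres_class_carrier l)+
    then show ?thesis using that False by (force simp: presented_gens_def)
  qed
  obtain u where u: "u \<in> gwords S" "g = pres_cong S R `` {u}"
    using assms by (rule presented_carrierE)
  have "set (map (\<lambda>p. pres_cong S R `` {[p]}) u) \<subseteq> ?X
      \<and> foldr (mult ?G) (map (\<lambda>p. pres_cong S R `` {[p]}) u) (one ?G) = pres_cong S R `` {u}"
    using u(1)
  proof (induction u)
    case Nil
    then show ?case by (simp add: presented_one)
  next
    case (Cons p u)
    then have pu: "p \<in> S \<times> UNIV" "[p] \<in> gwords S" "u \<in> gwords S" by (auto simp: gwords_def)
    have "pres_cong S R `` {[p]} \<in> ?X" using letter pu(1) by (cases p) auto
    with Cons.IH[OF pu(3)] show ?case by (simp add: pres_class_mult pu)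
  qed
  with u(2) show ?thesis by blast
qed


section \<open>Geometric realization of abstract simplicial complexes\<close>

text \<open>
  \<open>K\<close> is the set of non-empty finite simplices.  Points of the realization are given by
  barycentric coordinates; the type \<open>'p \<Rightarrow> real\<close> carries the product topology, which
  restricts to the Euclidean topology on every closed simplex.  The realization carries the weak
  (coherent) topology determined by its closed simplices.
\<close>

definition closed_simplex :: "'p set \<Rightarrow> ('p \<Rightarrow> real) set" where
  "closed_simplex \<sigma> = {f. (\<forall>v. 0 \<le> f v) \<and> (\<forall>v. v \<notin> \<sigma> \<longrightarrow> f v = 0) \<and> sum f \<sigma> = 1}"

definition geometric_realization :: "'p set set \<Rightarrow> ('p \<Rightarrow> real) topology" where
  "geometric_realization K = topology (\<lambda>U.
     U \<subseteq> (\<Union>\<sigma>\<in>K. closed_simplex \<sigma>) \<and>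
     (\<forall>\<sigma>\<in>K. openin (top_of_set (closed_simplex \<sigma>)) (U \<inter> closed_simplex \<sigma>)))"

lemma openin_geometric_realization:
  "openin (geometric_realization K) U \<longleftrightarrow>
     U \<subseteq> (\<Union>\<sigma>\<in>K. closed_simplex \<sigma>) \<and>
     (\<forall>\<sigma>\<in>K. openin (top_of_set (closed_simplex \<sigma>)) (U \<inter> closed_simplex \<sigma>))"
proof -
  have "istopology (\<lambda>U. U \<subseteq> (\<Union>\<sigma>\<in>K. closed_simplex \<sigma>) \<and>
     (\<forall>\<sigma>\<in>K. openin (top_of_set (closed_simplex \<sigma>)) (U \<inter> closed_simplex \<sigma>)))"
    unfolding istopology_def
  proof (intro conjI allI impI ballI)
    fix S T \<sigma>
    assume "S \<subseteq> (\<Union>\<sigma>\<in>K. closed_simplex \<sigma>) \<and>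
        (\<forall>\<sigma>\<in>K. openin (top_of_set (closed_simplex \<sigma>)) (S \<inter> closed_simplex \<sigma>))"
      and "T \<subseteq> (\<Union>\<sigma>\<in>K. closed_simplex \<sigma>) \<and>
        (\<forall>\<sigma>\<in>K. openin (top_of_set (closed_simplex \<sigma>)) (T \<inter> closed_simplex \<sigma>))"
      and "\<sigma> \<in> K"
    then have "openin (top_of_set (closed_simplex \<sigma>))
        ((S \<inter> closed_simplex \<sigma>) \<inter> (T \<inter> closed_simplex \<sigma>))"
      by (blast intro: openin_Int)
    then show "openin (top_of_set (closed_simplex \<sigma>)) (S \<inter> T \<inter> closed_simplex \<sigma>)"
      by (simp add: Int_ac)
  next
    fix \<U> \<sigma>
    assume "\<forall>S\<in>\<U>. S \<subseteq> (\<Union>\<sigma>\<in>K. closed_simplex \<sigma>) \<and>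
        (\<forall>\<sigma>\<in>K. openin (top_of_set (closed_simplex \<sigma>)) (S \<inter> closed_simplex \<sigma>))"
      and "\<sigma> \<in> K"
    then have "openin (top_of_set (closed_simplex \<sigma>)) (\<Union>S\<in>\<U>. S \<inter> closed_simplex \<sigma>)"
      by (intro openin_Union) auto
    then show "openin (top_of_set (closed_simplex \<sigma>)) (\<Union>\<U> \<inter> closed_simplex \<sigma>)"
      by (simp add: Int_commute Int_Union)
  qed blast+
  then show ?thesis
    unfolding geometric_realization_def by (simp add: topology_inverse')
qed

lemma topspace_geometric_realization:
  "topspace (geometric_realization K) = (\<Union>\<sigma>\<in>K. closed_simplex \<sigma>)"
proof
  show "topspace (geometric_realization K) \<subseteq> (\<Union>\<sigma>\<in>K. closed_simplex \<sigma>)"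
    using openin_topspace[of "geometric_realization K"]
    unfolding openin_geometric_realization by blast
  have "(\<Union>\<sigma>\<in>K. closed_simplex \<sigma>) \<inter> closed_simplex \<tau> = closed_simplex \<tau>" if "\<tau> \<in> K" for \<tau>
    using that by blast
  then have "openin (geometric_realization K) (\<Union>\<sigma>\<in>K. closed_simplex \<sigma>)"
    by (simp add: openin_geometric_realization)
  then show "(\<Union>\<sigma>\<in>K. closed_simplex \<sigma>) \<subseteq> topspace (geometric_realization K)"
    by (rule openin_subset)
qed


section \<open>Vietoris--Rips complexes\<close>

definition order_complex :: "'x set set \<Rightarrow> 'x set set set" where
  "order_complex P = {C. C \<subseteq> P \<and> finite C \<and> C \<noteq> {} \<and> chain\<^sub>\<subseteq> C}"

definition vr_poset :: "'g set \<Rightarrow> ('g \<Rightarrow> 'g \<Rightarrow> real) \<Rightarrow> real \<Rightarrow> 'g set set" where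
  "vr_poset X d t = {S. S \<subseteq> X \<and> finite S \<and> S \<noteq> {} \<and> (\<forall>g\<in>S. \<forall>h\<in>S. d g h \<le> t)}"

definition vietoris_rips :: "'g set \<Rightarrow> ('g \<Rightarrow> 'g \<Rightarrow> real) \<Rightarrow> real \<Rightarrow> ('g set \<Rightarrow> real) topology" where
  "vietoris_rips X d t = geometric_realization (order_complex (vr_poset X d t))"

definition raag_vietoris_rips ::
    "'a set \<Rightarrow> 'a set set \<Rightarrow> real \<Rightarrow> ('a gword set set \<Rightarrow> real) topology" where
  "raag_vietoris_rips V E t =
     vietoris_rips (carrier (raag V E)) (word_metric (raag V E) (raag_gens V E)) t"

text \<open>
  The library's \<open>contractible_space\<close> also holds of the empty space, but the complexes here are
  non-empty.
\<close>

lemma raag_vietoris_rips_nonempty: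
  assumes "0 \<le> t"
  shows "topspace (raag_vietoris_rips V E t) \<noteq> {}"
proof -
  let ?G = "raag V E" and ?v = "{\<one>\<^bsub>raag V E\<^esub>}"
  interpret group ?G unfolding raag_def by (rule group_presented_group)
  have "word_length ?G (raag_gens V E) \<one>\<^bsub>?G\<^esub> = 0"
    unfolding word_length_def by (rule Least_eq_0) simp
  then have "{?v} \<in> order_complex
      (vr_poset (carrier ?G) (word_metric ?G (raag_gens V E)) t)"
    using assms by (simp add: order_complex_def vr_poset_def word_metric_def chain_subset_def)
  moreover have "(\<lambda>S. if S = ?v then 1 else 0) \<in> closed_simplex {?v}"
    by (simp add: closed_simplex_def)
  ultimately show ?thesis
    unfolding raag_vietoris_rips_def vietoris_rips_def topspace_geometric_realization by blast
qed

end

theory Submission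
  imports Defs
begin

text \<open>
  Each \<open>g \<noteq> 1\<close> in \<open>A\<^sub>\<Gamma>\<close> has a strictly shorter \<open>h\<close> such that every element of length at most \<open>|g|\<close> within
  distance 2 of \<open>g\<close> is within distance 2 of \<open>h\<close>: the last letters of reduced words for \<open>g\<close> commute
  pairwise, so there are at most two of them in a triangle-free graph, and \<open>h\<close> is obtained by
  cancelling all of them. Any path of length at most 2 from \<open>g\<close> that does not leave the ball can be
  reordered so that it begins by cancelling one of these letters.

  Balls are finite, so the group can be enumerated by increasing length, and the complex is built by
  adding one dominated vertex at a time. In the order complex of the poset of cliques every such
  addition splits into steps that add a dominated clique, and undoing all steps successively on the
  time intervals \<open>[2\<^sup>-\<^sup>n\<^sup>-\<^sup>1, 2\<^sup>-\<^sup>n]\<close> is a contraction that is affine on every simplex.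
\<close>

section \<open>Maps into and out of geometric realizations\<close>

lemma closed_closed_simplex:
  assumes "finite \<sigma>"
  shows "closed (closed_simplex \<sigma>)"
proof -
  have eq: "closed_simplex \<sigma> =
      (\<Inter>v. {f. 0 \<le> f v}) \<inter> (\<Inter>v\<in>- \<sigma>. {f. f v = 0}) \<inter> {f. (\<Sum>v\<in>\<sigma>. f v) = 1}"
    by (auto simp: closed_simplex_def)
  have coord: "continuous_on UNIV (\<lambda>f :: 'a \<Rightarrow> real. f v)" for v
    by (rule continuous_on_product_coordinates)
  show ?thesis
    unfolding eq
    by (intro closed_Int closed_INT ballI closed_Collect_le closed_Collect_eq continuous_on_sum coord
        continuous_intros)
qed

lemma closed_simplex_subset_topspace:
  "\<sigma> \<in> K \<Longrightarrow> closed_simplex \<sigma> \<subseteq> topspace (geometric_realization K)"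
  by (auto simp: topspace_geometric_realization)

lemma closedin_geometric_realization_Int:
  assumes "closedin (geometric_realization K) C" "\<sigma> \<in> K"
  shows "closedin (top_of_set (closed_simplex \<sigma>)) (C \<inter> closed_simplex \<sigma>)"
proof -
  have "openin (top_of_set (closed_simplex \<sigma>))
      ((topspace (geometric_realization K) - C) \<inter> closed_simplex \<sigma>)"
    using assms unfolding closedin_def openin_geometric_realization by blast
  moreover have "(topspace (geometric_realization K) - C) \<inter> closed_simplex \<sigma>
      = closed_simplex \<sigma> - C \<inter> closed_simplex \<sigma>"
    using closed_simplex_subset_topspace[OF assms(2)] by blast
  ultimately show ?thesis
    by (simp add: closedin_def)
qed

text \<open>Continuity for the product topology suffices once finitely many simplices contain the
  image: a set closed in the weak topology meets each of them in a closed set, and a finite union of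
  these is closed.\<close>

lemma continuous_map_into_geometric_realization:
  assumes cont: "continuous_map X euclidean g"
    and T: "finite T" "T \<subseteq> K" "\<And>\<tau>. \<tau> \<in> T \<Longrightarrow> finite \<tau>"
    and im: "\<And>x. x \<in> topspace X \<Longrightarrow> \<exists>\<tau>\<in>T. g x \<in> closed_simplex \<tau>"
  shows "continuous_map X (geometric_realization K) g"
  unfolding continuous_map_closedin
proof (intro conjI allI impI)
  show "g \<in> topspace X \<rightarrow> topspace (geometric_realization K)"
    using im T(2) unfolding topspace_geometric_realization by blast
  fix C assume C: "closedin (geometric_realization K) C"
  have "closed (C \<inter> closed_simplex \<tau>)" if "\<tau> \<in> T" for \<tau>
    using closedin_geometric_realization_Int[OF C] T that closed_closed_simplex
    by (metis closedin_closed_trans subsetD)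
  then have "closed (\<Union>\<tau>\<in>T. C \<inter> closed_simplex \<tau>)"
    using T(1) by (intro closed_UN) auto
  then have "closedin X {x \<in> topspace X. g x \<in> (\<Union>\<tau>\<in>T. C \<inter> closed_simplex \<tau>)}"
    using cont by (intro closedin_continuous_map_preimage[OF cont]) simp
  moreover have "{x \<in> topspace X. g x \<in> (\<Union>\<tau>\<in>T. C \<inter> closed_simplex \<tau>)} = {x \<in> topspace X. g x \<in> C}"
    using im by blast
  ultimately show "closedin X {x \<in> topspace X. g x \<in> C}"
    by simp
qed

section \<open>Realizations as quotients of disjoint unions of simplices\<close>

definition simplex_sum :: "'p set set \<Rightarrow> ('p set \<times> ('p \<Rightarrow> real)) topology" where
  "simplex_sum K = sum_topology (\<lambda>\<sigma>. top_of_set (closed_simplex \<sigma>)) K"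

lemma topspace_simplex_sum: "topspace (simplex_sum K) = Sigma K closed_simplex"
  by (auto simp: simplex_sum_def)

text \<open>The weak topology is the final topology for the inclusions of the closed simplices,
  which is exactly the quotient topology under \<open>snd\<close>.\<close>

lemma quotient_map_simplex_sum: "quotient_map (simplex_sum K) (geometric_realization K) snd"
  unfolding quotient_map_def
proof (intro conjI allI impI)
  show "snd ` topspace (simplex_sum K) = topspace (geometric_realization K)"
    by (force simp: topspace_simplex_sum topspace_geometric_realization)
  fix U assume U: "U \<subseteq> topspace (geometric_realization K)"
  have "{x. (\<sigma>, x) \<in> {z \<in> topspace (simplex_sum K). snd z \<in> U}} = U \<inter> closed_simplex \<sigma>" if "\<sigma> \<in> K" for \<sigma>
    using that by (auto simp: topspace_simplex_sum)
  moreover have "{z \<in> topspace (simplex_sum K). snd z \<in> U}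
      \<subseteq> Sigma K (topspace \<circ> (\<lambda>\<sigma>. top_of_set (closed_simplex \<sigma>)))"
    by (auto simp: topspace_simplex_sum)
  ultimately show "openin (simplex_sum K) {z \<in> topspace (simplex_sum K). snd z \<in> U} \<longleftrightarrow>
      openin (geometric_realization K) U"
    using U unfolding openin_geometric_realization topspace_geometric_realization
    by (subst simplex_sum_def, subst openin_sum_topology) simp
qed

lemma continuous_map_snd_simplex_sum: "continuous_map (simplex_sum K) euclidean snd"
proof -
  have "openin (simplex_sum K) {z \<in> topspace (simplex_sum K). snd z \<in> U}" if "open U" for U
  proof -
    have "{x. (\<sigma>, x) \<in> {z \<in> topspace (simplex_sum K). snd z \<in> U}} = closed_simplex \<sigma> \<inter> U" if "\<sigma> \<in> K" for \<sigma>
      using that by (auto simp: topspace_simplex_sum)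
    then show ?thesis
      using that
      by (subst simplex_sum_def, subst openin_sum_topology)
        (auto simp: topspace_simplex_sum openin_open_Int)
  qed
  then show ?thesis by (simp add: continuous_map_def)
qed

text \<open>The unit interval is locally compact, so taking the product with it preserves the quotient map
  from the disjoint union of the closed simplices.\<close>

lemma continuous_map_from_interval_times_realization:
  fixes h :: "real \<times> ('p \<Rightarrow> real) \<Rightarrow> 'b"
  assumes loc: "\<And>\<sigma>. \<sigma> \<in> K \<Longrightarrow> \<exists>g.
      continuous_map (prod_topology (top_of_set {0..1}) (top_of_set (closed_simplex \<sigma>))) Y g
      \<and> (\<forall>t\<in>{0..1}. \<forall>x\<in>closed_simplex \<sigma>. g (t, x) = h (t, x))"
  shows "continuous_map (prod_topology (top_of_set {0..1}) (geometric_realization K)) Y h"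
proof -
  let ?Z = "top_of_set {0..1::real}"
  let ?X = "prod_topology ?Z (simplex_sum K)"
  have "quotient_map ?X (prod_topology ?Z (geometric_realization K)) (\<lambda>(t, z). (t, snd z))"
    by (rule quotient_map_prod_right[OF _ _ quotient_map_simplex_sum])
      (auto simp: Hausdorff_space_subtopology compact_space_subtopology intro!: compact_imp_locally_compact_space)
  moreover have "continuous_map ?X Y (h \<circ> (\<lambda>(t, z). (t, snd z)))"
  \<comment> \<open>The summands are open in the disjoint union, so continuity may be checked on
    each separately.\<close>
  proof (rule pasting_lemma[where I = K and T = "\<lambda>\<sigma>. {0..1} \<times> ({\<sigma>} \<times> closed_simplex \<sigma>)"
        and f = "\<lambda>\<sigma>. h \<circ> (\<lambda>(t, z). (t, snd z))"])
    fix \<sigma> assume \<sigma>: "\<sigma> \<in> K"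
    have "{x. (\<tau>, x) \<in> {\<sigma>} \<times> closed_simplex \<sigma>} = (if \<tau> = \<sigma> then closed_simplex \<tau> else {})" for \<tau>
      by auto
    then have "openin (simplex_sum K) ({\<sigma>} \<times> closed_simplex \<sigma>)"
      using \<sigma> unfolding simplex_sum_def openin_sum_topology by auto
    then show "openin ?X ({0..1} \<times> ({\<sigma>} \<times> closed_simplex \<sigma>))"
      by (simp add: openin_prod_Times_iff)
    obtain g where g: "continuous_map (prod_topology ?Z (top_of_set (closed_simplex \<sigma>))) Y g"
      "\<forall>t\<in>{0..1}. \<forall>x\<in>closed_simplex \<sigma>. g (t, x) = h (t, x)"
      using loc[OF \<sigma>] by blast
    let ?S = "subtopology ?X ({0..1} \<times> ({\<sigma>} \<times> closed_simplex \<sigma>))"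
    have "continuous_map ?S (prod_topology ?Z (top_of_set (closed_simplex \<sigma>))) (\<lambda>(t, z). (t, snd z))"
    proof -
      have "continuous_map ?S ?Z fst"
        by (intro continuous_map_from_subtopology continuous_map_fst)
      moreover have "continuous_map ?S (top_of_set (closed_simplex \<sigma>)) (snd \<circ> snd)"
        unfolding continuous_map_in_subtopology
        by (intro conjI continuous_map_from_subtopology continuous_map_compose
            [OF continuous_map_snd continuous_map_snd_simplex_sum]) auto
      ultimately show ?thesis
        unfolding continuous_map_pairwise by (simp add: case_prod_unfold o_def)
    qed
    then have "continuous_map ?S Y (g \<circ> (\<lambda>(t, z). (t, snd z)))"
      using g(1) by (rule continuous_map_compose)
    then show "continuous_map ?S Y (h \<circ> (\<lambda>(t, z). (t, snd z)))"
      by (rule continuous_map_eq) (use g(2) in auto)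
  qed (auto simp: topspace_simplex_sum)
  ultimately show ?thesis
    by (rule continuous_compose_quotient_map)
qed


section \<open>Collapsing a complex one vertex rk at a time\<close>

text \<open>Iterates \<open>f\<close> until the rank is at most \<open>n\<close>. The second
  stopping condition only secures termination for arbitrary arguments; at vertices of the complex it
  never stops the iteration early.\<close>

function push_below :: "('p \<Rightarrow> nat) \<Rightarrow> ('p \<Rightarrow> 'p) \<Rightarrow> nat \<Rightarrow> 'p \<Rightarrow> 'p" where
  "push_below rk f n p =
     (if rk p \<le> n \<or> \<not> rk (f p) < rk p then p else push_below rk f n (f p))"
  by auto
termination
  by (relation "Wellfounded.measure (\<lambda>(rk, f, n, p). rk p)") auto

declare push_below.simps [simp del]

section \<open>The time schedule of the homotopy\<close>

text \<open>Rises linearly from 0 at time \<open>1 / 2 ^ Suc n\<close> to 1 at time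
  \<open>1 / 2 ^ n\<close>, so higher ranks are treated first and the active intervals accumulate
  only at time 0.\<close>

definition ramp :: "nat \<Rightarrow> real \<Rightarrow> real" where
  "ramp n t = min 1 (max 0 (2 ^ Suc n * t - 1))"

lemma ramp_0: "ramp n 0 = 0"
  and ramp_1: "ramp n 1 = 1"
  and ramp_nonneg: "0 \<le> ramp n t"
  and ramp_le_1: "ramp n t \<le> 1"
  using one_le_power[of "2::real" "Suc n"] by (auto simp: ramp_def min_def max_def)

lemma continuous_on_ramp: "continuous_on S (ramp n)"
  unfolding ramp_def[abs_def] by (intro continuous_intros)

lemma ramp_profile:
  assumes "0 < t"
  obtains m where "\<And>n. n < m \<Longrightarrow> ramp n t = 0" "\<And>n. m < n \<Longrightarrow> ramp n t = 1"
proof -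
  \<comment> \<open>The ramp in progress at time \<open>t\<close>: those of smaller index have not
    started, those of larger index are finished.\<close>
  define m where "m = (LEAST m. 1 < 2 ^ Suc m * t)"
  obtain k where "1 / t < 2 ^ k"
    using real_arch_pow[of 2 "1 / t"] by auto
  then have "1 < 2 ^ Suc k * t"
    using assms by (simp add: field_simps)
  then have m: "1 < 2 ^ Suc m * t"
    unfolding m_def by (rule LeastI)
  show ?thesis
  proof
    fix n assume "n < m"
    then have "\<not> 1 < 2 ^ Suc n * t"
      unfolding m_def by (rule not_less_Least)
    then show "ramp n t = 0" by (simp add: ramp_def)
  next
    fix n assume "m < n"
    then have "(2::real) ^ Suc (Suc m) \<le> 2 ^ Suc n"
      by (intro power_increasing) auto
    then have "2 ^ Suc (Suc m) * t \<le> 2 ^ Suc n * t"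
      using assms by (intro mult_right_mono) auto
    moreover have "2 ^ Suc (Suc m) * t = 2 * (2 ^ Suc m * t)" by simp
    ultimately have "2 \<le> 2 ^ Suc n * t" using m by linarith
    then show "ramp n t = 1" by (simp add: ramp_def)
  qed
qed

text \<open>The terms beyond \<open>m\<close> telescope and bring \<open>b N\<close> to
  \<open>b (Suc m)\<close>; the term at \<open>m\<close> is the only partial one, so a point on the
  segment from \<open>b (Suc m)\<close> to \<open>b m\<close> remains.\<close>

lemma sum_telescope_ramp:
  fixes b :: "nat \<Rightarrow> real"
  assumes c: "\<And>n. n < m \<Longrightarrow> c n = 0" "\<And>n. m < n \<Longrightarrow> c n = 1" and m: "m < N"
  shows "b N + (\<Sum>n<N. c n * (b n - b (Suc n))) = (1 - c m) * b (Suc m) + c m * b m"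
  using m
proof (induction N)
  case (Suc N)
  show ?case
  proof (cases "m = N")
    case True
    then have "(\<Sum>n<N. c n * (b n - b (Suc n))) = 0"
      using c(1) by (intro sum.neutral) auto
    then show ?thesis using True by (simp add: algebra_simps)
  next
    case False
    then show ?thesis using Suc c(2)[of N] by (simp add: algebra_simps)
  qed
qed simp

text \<open>The axiom \<open>cone\<close> says that \<open>f p\<close> dominates \<open>p\<close>
  among the vertices of rank at most \<open>rk p\<close>. Ranks separate only the vertices of a
  common simplex, so vertices sharing no simplex may move simultaneously.\<close>

locale ranked_collapse =
  fixes K :: "'p set set" and rk :: "'p \<Rightarrow> nat" and f :: "'p \<Rightarrow> 'p" and base :: 'p
  assumes finite_simplex: "\<sigma> \<in> K \<Longrightarrow> finite \<sigma>"
    and face: "\<sigma> \<in> K \<Longrightarrow> \<tau> \<subseteq> \<sigma> \<Longrightarrow> \<tau> \<noteq> {} \<Longrightarrow> \<tau> \<in> K"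
    and simplex_nonempty: "\<sigma> \<in> K \<Longrightarrow> \<sigma> \<noteq> {}"
    and rk_inj: "\<sigma> \<in> K \<Longrightarrow> inj_on rk \<sigma>"
    and rk_less: "\<sigma> \<in> K \<Longrightarrow> p \<in> \<sigma> \<Longrightarrow> 0 < rk p \<Longrightarrow> rk (f p) < rk p"
    and cone: "\<sigma> \<in> K \<Longrightarrow> p \<in> \<sigma> \<Longrightarrow> 0 < rk p \<Longrightarrow> (\<And>q. q \<in> \<sigma> \<Longrightarrow> rk q \<le> rk p) \<Longrightarrow>
      insert (f p) \<sigma> \<in> K"
    and rk_0: "\<sigma> \<in> K \<Longrightarrow> p \<in> \<sigma> \<Longrightarrow> rk p = 0 \<Longrightarrow> p = base"
begin

abbreviation "a \<equiv> push_below rk f"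

section \<open>Stages of the collapse on vertices and simplices\<close>

lemma a_id: "rk p \<le> n \<Longrightarrow> a n p = p"
  by (simp add: push_below.simps)

lemma a_step: "\<sigma> \<in> K \<Longrightarrow> p \<in> \<sigma> \<Longrightarrow> n < rk p \<Longrightarrow> a n p = a n (f p)"
  using rk_less[of \<sigma> p] by (subst push_below.simps) auto

lemma f_vertex: "\<sigma> \<in> K \<Longrightarrow> p \<in> \<sigma> \<Longrightarrow> 0 < rk p \<Longrightarrow> {f p} \<in> K"
  using face[of \<sigma> "{p}"] cone[of "{p}" p] face[of "insert (f p) {p}" "{f p}"] by auto

lemma rk_a_le: "{p} \<in> K \<Longrightarrow> rk (a n p) \<le> n"
proof (induction "rk p" arbitrary: p rule: less_induct)
  case less
  show ?case
  proof (cases "rk p \<le> n")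
    case False
    then show ?thesis
      using less rk_less[of "{p}" p] f_vertex[of "{p}" p] a_step[of "{p}" p n] by auto
  qed (simp add: a_id)
qed

text \<open>Shows that successive stages differ by at most one application of \<open>f\<close>. The
  induction follows the orbit of \<open>p\<close> down to rank at most \<open>Suc n\<close>.\<close>

lemma a_Suc: "{p} \<in> K \<Longrightarrow>
    a n p = (if rk (a (Suc n) p) = Suc n then f (a (Suc n) p) else a (Suc n) p)"
proof (induction "rk p" arbitrary: p rule: less_induct)
  case less
  consider "rk p \<le> n" | "rk p = Suc n" | "Suc n < rk p" by linarith
  then show ?case
  proof cases
    case 2
    then show ?thesis
      using less.prems rk_less[of "{p}" p] a_step[of "{p}" p n] by (auto simp: a_id)
  next
    case 3
    then show ?thesis
      using less rk_less[of "{p}" p] f_vertex[of "{p}" p]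
        a_step[of "{p}" p n] a_step[of "{p}" p "Suc n"] by auto
  qed (simp add: a_id)
qed

lemma vertex: "\<sigma> \<in> K \<Longrightarrow> p \<in> \<sigma> \<Longrightarrow> {p} \<in> K"
  using face[of \<sigma> "{p}"] by auto

text \<open>By injectivity of the rank at most one vertex of the stage \<open>Suc n\<close> image
  has rank \<open>Suc n\<close>. It is the top vertex, so \<open>cone\<close> supplies its image
  under \<open>f\<close>, and all other vertices stay fixed.\<close>

lemma a_image_union_aux:
  assumes \<sigma>: "\<sigma> \<in> K" and a\<sigma>: "a (Suc n) ` \<sigma> \<in> K"
  shows "a (Suc n) ` \<sigma> \<union> a n ` \<sigma> \<in> K"
proof (cases "\<exists>q\<in>a (Suc n) ` \<sigma>. rk q = Suc n")
  case True
  then obtain q where q: "q \<in> a (Suc n) ` \<sigma>" "rk q = Suc n" by blast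
  have "insert (f q) (a (Suc n) ` \<sigma>) \<in> K"
    using q rk_a_le vertex[OF \<sigma>] by (intro cone[OF a\<sigma>]) auto
  moreover have "a n ` \<sigma> \<subseteq> insert (f q) (a (Suc n) ` \<sigma>)"
  proof (rule image_subsetI)
    fix p assume p: "p \<in> \<sigma>"
    show "a n p \<in> insert (f q) (a (Suc n) ` \<sigma>)"
    proof (cases "rk (a (Suc n) p) = Suc n")
      case True
      then have "a (Suc n) p = q"
        using inj_onD[OF rk_inj[OF a\<sigma>]] p q by auto
      then show ?thesis using a_Suc[OF vertex[OF \<sigma> p], of n] True by simp
    qed (use a_Suc[OF vertex[OF \<sigma> p], of n] p in simp)
  qed
  ultimately show ?thesis
    using simplex_nonempty[OF \<sigma>] by (auto elim!: face)
next
  case False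
  then have "a n p = a (Suc n) p" if "p \<in> \<sigma>" for p
    using a_Suc[OF vertex[OF \<sigma> that], of n] that by auto
  then show ?thesis using a\<sigma> by simp
qed

text \<open>Downward induction on the stage, starting above all ranks in the simplex, where nothing
  has moved yet.\<close>

lemma a_image_simplex: "\<sigma> \<in> K \<Longrightarrow> a n ` \<sigma> \<in> K"
proof -
  assume \<sigma>: "\<sigma> \<in> K"
  obtain N where N: "\<forall>p\<in>\<sigma>. rk p \<le> N"
    using finite_simplex[OF \<sigma>] finite_nat_set_iff_bounded_le[of "rk ` \<sigma>"] by auto
  have top: "a n ` \<sigma> \<in> K" if "N \<le> n" for n
  proof -
    have "a n ` \<sigma> = \<sigma>" using N that by (force simp: a_id)
    then show ?thesis using \<sigma> by simp
  qed
  show ?thesis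
  proof (cases "n \<le> N")
    case True
    then show ?thesis
    proof (induction n rule: inc_induct)
      case (step n)
      from a_image_union_aux[OF \<sigma> step.IH] show ?case
        by (rule face) (use simplex_nonempty[OF \<sigma>] in auto)
    qed (use top in simp)
  qed (use top in simp)
qed

lemma a_image_union: "\<sigma> \<in> K \<Longrightarrow> a (Suc n) ` \<sigma> \<union> a n ` \<sigma> \<in> K"
  by (intro a_image_union_aux a_image_simplex)

section \<open>The homotopy on vertices and simplices\<close>

text \<open>The path of the vertex \<open>p\<close> in barycentric coordinates: as \<open>t\<close> grows from \<open>2\<^sup>-\<^sup>n\<^sup>-\<^sup>1\<close> to \<open>2\<^sup>-\<^sup>n\<close>
  it moves linearly from \<open>a (Suc n) p\<close> to \<open>a n p\<close>.\<close>

definition vertex_path :: "'p \<Rightarrow> real \<Rightarrow> 'p \<Rightarrow> real" where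
  "vertex_path p t q = indicator {p} q +
     (\<Sum>n<rk p. ramp n t * (indicator {a n p} q - indicator {a (Suc n) p} q))"

text \<open>The affine extension of the vertex paths. Summing over the support of the point makes
  the value independent of a choice of simplex containing it.\<close>

definition slide :: "real \<times> ('p \<Rightarrow> real) \<Rightarrow> 'p \<Rightarrow> real" where
  "slide z q = (\<Sum>p | snd z p \<noteq> 0. snd z p * vertex_path p (fst z) q)"

text \<open>Terms with \<open>n\<close> at least \<open>rk p\<close> vanish, so all vertices of a
  simplex can use a common number of terms.\<close>

lemma vertex_path_extend:
  assumes "rk p \<le> N"
  shows "vertex_path p t q = indicator {a N p} q +
     (\<Sum>n<N. ramp n t * (indicator {a n p} q - indicator {a (Suc n) p} q))"
  using assms
proof (induction N rule: dec_induct)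
  case base
  then show ?case by (simp add: vertex_path_def a_id)
next
  case (step N)
  then show ?case by (simp add: a_id)
qed

lemma continuous_on_vertex_path: "continuous_on S (\<lambda>t. vertex_path p t q)"
  unfolding vertex_path_def by (intro continuous_intros continuous_on_ramp)

lemma vertex_path_0: "vertex_path p 0 = indicator {p}"
  by (simp add: vertex_path_def ramp_0 fun_eq_iff)

text \<open>All ramps are complete, so the sum telescopes to \<open>a 0 p\<close>, a vertex of rank
  0.\<close>

lemma vertex_path_1:
  assumes "{p} \<in> K"
  shows "vertex_path p 1 = indicator {base}"
proof
  fix q
  have "vertex_path p 1 q = indicator {a (rk p) p} q - (\<Sum>n<rk p. indicator {a (Suc n) p} q - indicator {a n p} q)"
    by (simp add: vertex_path_def ramp_1 a_id sum_subtractf)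
  also have "\<dots> = indicator {a 0 p} q"
    by (subst sum_lessThan_telescope) simp
  also have "a 0 p = base"
    using rk_0[OF _ _ , of "{a 0 p}" "a 0 p"] a_image_simplex[OF assms, of 0] rk_a_le[OF assms, of 0]
    by simp
  finally show "vertex_path p 1 q = indicator {base} q" .
qed

text \<open>The point of the statement is that \<open>m\<close> and \<open>c\<close> depend on the
  time and the simplex but not on the vertex; this keeps the image of a whole simplex inside the
  union of two consecutive stages.\<close>

lemma vertex_path_two_vertices:
  assumes "\<sigma> \<in> K" "0 \<le> t"
  obtains m c where "0 \<le> c" "c \<le> 1"
    "\<And>p q. p \<in> \<sigma> \<Longrightarrow> vertex_path p t q = (1 - c) * indicator {a (Suc m) p} q + c * indicator {a m p} q"
proof (cases "t = 0")
  case True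
  obtain N where N: "\<forall>p\<in>\<sigma>. rk p \<le> N"
    using finite_simplex[OF assms(1)] finite_nat_set_iff_bounded_le[of "rk ` \<sigma>"] by auto
  show ?thesis
    \<comment> \<open>No ramp is active at time 0; any stage above all ranks describes the resting
      vertices.\<close>
    by (rule that[of 0 N]) (use N True in \<open>auto simp: vertex_path_0 a_id\<close>)
next
  case False
  then have "0 < t" using assms(2) by simp
  then obtain m where m: "\<And>n. n < m \<Longrightarrow> ramp n t = 0" "\<And>n. m < n \<Longrightarrow> ramp n t = 1"
    by (rule ramp_profile) blast
  show ?thesis
  proof (rule that[of "ramp m t" m])
    fix p q
    show "vertex_path p t q = (1 - ramp m t) * indicator {a (Suc m) p} q + ramp m t * indicator {a m p} q"
      \<comment> \<open>The number of terms must be at least \<open>rk p\<close> for the extension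
        and exceed \<open>m\<close> for the telescoping.\<close>
      by (rule HOL.trans[OF vertex_path_extend[of p "rk p + Suc m"] sum_telescope_ramp[OF m]]) auto
  qed (rule ramp_nonneg ramp_le_1)+
qed

lemma slide_on_simplex:
  assumes "\<sigma> \<in> K" "x \<in> closed_simplex \<sigma>"
  shows "slide (t, x) q = (\<Sum>p\<in>\<sigma>. x p * vertex_path p t q)"
  unfolding slide_def fst_conv snd_conv
  by (rule sum.mono_neutral_left) (use assms finite_simplex in \<open>auto simp: closed_simplex_def\<close>)

lemma slide_in_simplex:
  assumes "\<sigma> \<in> K" "x \<in> closed_simplex \<sigma>" "0 \<le> t"
  obtains m where "slide (t, x) \<in> closed_simplex (a (Suc m) ` \<sigma> \<union> a m ` \<sigma>)"
proof -
  obtain m c where c: "0 \<le> c" "c \<le> 1"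
    and vertex_path: "\<And>p q. p \<in> \<sigma> \<Longrightarrow> vertex_path p t q = (1 - c) * indicator {a (Suc m) p} q + c * indicator {a m p} q"
    using vertex_path_two_vertices[OF assms(1,3)] by metis
  let ?\<tau> = "a (Suc m) ` \<sigma> \<union> a m ` \<sigma>"
  have fin: "finite \<sigma>" "finite ?\<tau>" using finite_simplex[OF assms(1)] by auto
  have x: "\<And>p. 0 \<le> x p" "sum x \<sigma> = 1" using assms(2) by (auto simp: closed_simplex_def)
  have slide: "slide (t, x) q =
      (\<Sum>p\<in>\<sigma>. x p * ((1 - c) * indicator {a (Suc m) p} q + c * indicator {a m p} q))" for q
    unfolding slide_on_simplex[OF assms(1,2)] by (rule sum.cong) (simp_all add: vertex_path)
  have "sum (slide (t, x)) ?\<tau> =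
      (\<Sum>p\<in>\<sigma>. \<Sum>q\<in>?\<tau>. x p * ((1 - c) * indicator {a (Suc m) p} q + c * indicator {a m p} q))"
    unfolding slide by (rule sum.swap)
  also have "\<dots> = (\<Sum>p\<in>\<sigma>. x p)"
  proof (rule sum.cong[OF HOL.refl])
    fix p assume p: "p \<in> \<sigma>"
    have "(\<Sum>q\<in>?\<tau>. indicator {r} q) = (1::real)" if "r \<in> ?\<tau>" for r
      using fin(2) that by (simp add: indicator_def of_bool_def)
    with p show "(\<Sum>q\<in>?\<tau>. x p * ((1 - c) * indicator {a (Suc m) p} q + c * indicator {a m p} q)) = x p"
      by (simp add: sum_distrib_left[symmetric] sum.distrib)
  qed
  finally have "sum (slide (t, x)) ?\<tau> = 1" using x by simp
  moreover have "0 \<le> slide (t, x) q" for q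
    unfolding slide using x c by (intro sum_nonneg mult_nonneg_nonneg add_nonneg_nonneg) auto
  moreover have "slide (t, x) q = 0" if "q \<notin> ?\<tau>" for q
    unfolding slide using that by (intro sum.neutral) (auto simp: indicator_def)
  ultimately show ?thesis
    by (intro that[of m]) (simp add: closed_simplex_def)
qed

text \<open>On one closed simplex the formula is a finite sum with continuous coordinates, and its
  values lie in finitely many simplices of the complex.\<close>

lemma continuous_map_slide:
  "continuous_map (prod_topology (top_of_set {0..1}) (geometric_realization K))
     (geometric_realization K) slide"
proof (rule continuous_map_from_interval_times_realization)
  fix \<sigma> assume \<sigma>: "\<sigma> \<in> K"
  obtain N where N: "\<forall>p\<in>\<sigma>. rk p \<le> N"
    using finite_simplex[OF \<sigma>] finite_nat_set_iff_bounded_le[of "rk ` \<sigma>"] by auto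
  let ?P = "prod_topology (top_of_set {0..1::real}) (top_of_set (closed_simplex \<sigma>))"
  let ?g = "\<lambda>z q. \<Sum>p\<in>\<sigma>. snd z p * vertex_path p (fst z) q"
  \<comment> \<open>Stages from \<open>N\<close> on do not move the simplex, so finitely many unions
    suffice; hence \<open>min m N\<close> below.\<close>
  let ?T = "(\<lambda>m. a (Suc m) ` \<sigma> \<union> a m ` \<sigma>) ` {..N}"
  have eq: "?g (t, x) = slide (t, x)" if "x \<in> closed_simplex \<sigma>" for t x
    using slide_on_simplex[OF \<sigma> that] by auto
  have "continuous_on ({0..1} \<times> closed_simplex \<sigma>) ?g"
  proof (intro continuous_on_coordinatewise_then_product continuous_on_sum continuous_on_mult)
    fix p q
    show "continuous_on ({0..1} \<times> closed_simplex \<sigma>) (\<lambda>z. snd z p)"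
      by (rule continuous_on_compose2[OF continuous_on_product_coordinates])
        (auto intro: continuous_on_snd continuous_on_id)
    show "continuous_on ({0..1} \<times> closed_simplex \<sigma>) (\<lambda>z. vertex_path p (fst z) q)"
      by (rule continuous_on_compose2[OF continuous_on_vertex_path])
        (auto intro: continuous_on_fst continuous_on_id)
  qed
  then have cont: "continuous_map ?P euclidean ?g"
    by simp
  have "continuous_map ?P (geometric_realization K) ?g"
  proof (rule continuous_map_into_geometric_realization[OF cont, where T = ?T])
    show "?T \<subseteq> K" using a_image_union[OF \<sigma>] by auto
    show "finite \<tau>" if "\<tau> \<in> ?T" for \<tau> using that finite_simplex[OF \<sigma>] by auto
    fix z assume "z \<in> topspace ?P"
    then obtain t :: real and x where z: "z = (t, x)" "0 \<le> t" "x \<in> closed_simplex \<sigma>" by auto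
    obtain m where m: "slide (t, x) \<in> closed_simplex (a (Suc m) ` \<sigma> \<union> a m ` \<sigma>)"
      using slide_in_simplex[OF \<sigma> z(3,2)] .
    have "a m ` \<sigma> = a (min m N) ` \<sigma> \<and> a (Suc m) ` \<sigma> = a (Suc (min m N)) ` \<sigma>"
    proof (cases "m \<le> N")
      case False
      then show ?thesis using N by (intro conjI image_cong) (auto simp: a_id le_trans)
    qed simp
    then have "?g z \<in> closed_simplex (a (Suc (min m N)) ` \<sigma> \<union> a (min m N) ` \<sigma>)"
      using m eq[OF z(3), of t] z(1) by simp
    then show "\<exists>\<tau>\<in>?T. ?g z \<in> closed_simplex \<tau>" by auto
  qed simp
  then show "\<exists>g. continuous_map ?P (geometric_realization K) g
      \<and> (\<forall>t\<in>{0..1}. \<forall>x\<in>closed_simplex \<sigma>. g (t, x) = slide (t, x))"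
    using eq by (intro exI[of _ ?g]) auto
qed

theorem contractible_geometric_realization: "contractible_space (geometric_realization K)"
  unfolding contractible_space_def
proof (subst homotopic_with)
  have ends: "slide (0, x) = x \<and> slide (1, x) = indicator {base}"
    if x: "x \<in> topspace (geometric_realization K)" for x
  proof -
    obtain \<sigma> where \<sigma>: "\<sigma> \<in> K" "x \<in> closed_simplex \<sigma>"
      using x by (auto simp: topspace_geometric_realization)
    note fin = finite_simplex[OF \<sigma>(1)]
    have "slide (0, x) q = x q" for q
    proof -
      have "slide (0, x) q = (\<Sum>p\<in>\<sigma>. if p = q then x p else 0)"
        unfolding slide_on_simplex[OF \<sigma>] vertex_path_0 by (rule sum.cong) auto
      then show ?thesis
        using fin \<sigma>(2) by (auto simp: closed_simplex_def)
    qed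
    moreover have "slide (1, x) q = indicator {base} q" for q
    proof -
      have "slide (1, x) q = (\<Sum>p\<in>\<sigma>. x p * indicator {base} q)"
        unfolding slide_on_simplex[OF \<sigma>] by (rule sum.cong) (simp_all add: vertex_path_1 vertex[OF \<sigma>(1)])
      then show ?thesis
        using \<sigma>(2) by (simp add: sum_distrib_right[symmetric] closed_simplex_def)
    qed
    ultimately show ?thesis by auto
  qed
  show "\<exists>c h. continuous_map (prod_topology (top_of_set {0..1::real}) (geometric_realization K))
        (geometric_realization K) h
      \<and> (\<forall>x\<in>topspace (geometric_realization K). h (0, x) = id x)
      \<and> (\<forall>x\<in>topspace (geometric_realization K). h (1, x) = c)
      \<and> (\<forall>t\<in>{0..1}. True)"
    by (rule exI[of _ "indicator {base}"], rule exI[of _ slide])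
      (use ends continuous_map_slide in auto)
qed simp

end


section \<open>Dismantlable Vietoris--Rips complexes\<close>

text \<open>Domination concerns only neighbours enumerated no later than \<open>x\<close>, that is,
  the subcomplex built so far. Fixing \<open>h\<close> at index 0 gives the first singleton clique
  rank 0.\<close>

locale dismantling =
  fixes X :: "'g set" and d :: "'g \<Rightarrow> 'g \<Rightarrow> real" and t :: real and idx :: "'g \<Rightarrow> nat" and h :: "'g \<Rightarrow> 'g"
  assumes idx_inj: "inj_on idx X"
    and d_sym: "x \<in> X \<Longrightarrow> y \<in> X \<Longrightarrow> d x y = d y x"
    and d_refl: "x \<in> X \<Longrightarrow> d x x \<le> t"
    and h_in: "x \<in> X \<Longrightarrow> h x \<in> X"
    and idx_h: "x \<in> X \<Longrightarrow> 0 < idx x \<Longrightarrow> idx (h x) < idx x"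
    and h_0: "x \<in> X \<Longrightarrow> idx x = 0 \<Longrightarrow> h x = x"
    and h_dominates: "x \<in> X \<Longrightarrow> y \<in> X \<Longrightarrow> idx y \<le> idx x \<Longrightarrow> d x y \<le> t \<Longrightarrow> d (h x) y \<le> t"
begin

abbreviation "P \<equiv> vr_poset X d t"

section \<open>Cliques ordered by their last vertex\<close>

definition apex_idx :: "'g set \<Rightarrow> nat" where
  "apex_idx S = Max (idx ` S)"

text \<open>Recovering the vertex from its index makes cliques with equal \<open>apex_idx\<close>
  share their apex by definition.\<close>

definition apex :: "'g set \<Rightarrow> 'g" where
  "apex S = inv_into X idx (apex_idx S)"

text \<open>The cliques with top vertex \<open>v\<close> are collapsed onto the earlier ones by first adding \<open>h v\<close> and
  then deleting \<open>v\<close>. The rank lists them in an order in which each step moves a single vertex of the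
  order complex: cliques containing \<open>h v\<close> come before the others, the former by decreasing and
  the latter by increasing size.\<close>

definition clique_rank :: "'g set \<Rightarrow> nat" where
  "clique_rank S = apex_idx S * (apex_idx S + 2) +
     (if h (apex S) \<in> S then apex_idx S + 1 - card S else apex_idx S + 1 + card S)"

definition clique_step :: "'g set \<Rightarrow> 'g set" where
  "clique_step S = (if h (apex S) \<in> S then S - {apex S} else insert (h (apex S)) S)"

lemma P_D:
  assumes "S \<in> P"
  shows "S \<subseteq> X" "finite S" "S \<noteq> {}" "x \<in> S \<Longrightarrow> y \<in> S \<Longrightarrow> d x y \<le> t"
  using assms by (auto simp: vr_poset_def)

lemma idx_le_apex_idx: "S \<in> P \<Longrightarrow> x \<in> S \<Longrightarrow> idx x \<le> apex_idx S"
  by (simp add: apex_idx_def P_D)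

lemma idx_eq_apex_idx: "S \<in> P \<Longrightarrow> x \<in> S \<Longrightarrow> idx x = apex_idx S \<Longrightarrow> apex S = x"
  using idx_inj P_D(1) by (metis inv_into_f_f subsetD apex_def)

lemma
  assumes "S \<in> P"
  shows apex_in: "apex S \<in> S" and idx_apex: "idx (apex S) = apex_idx S"
proof -
  have "apex_idx S \<in> idx ` S"
    unfolding apex_idx_def using P_D[OF assms] by (intro Max_in) auto
  then obtain x where "x \<in> S" "idx x = apex_idx S" by auto
  then show "apex S \<in> S" "idx (apex S) = apex_idx S"
    using idx_eq_apex_idx[OF assms] by auto
qed

lemma apex_idx_eqI:
  assumes "S \<in> P" "\<And>x. x \<in> S \<Longrightarrow> idx x \<le> idx y" "y \<in> S"
  shows "apex_idx S = idx y"
  using assms idx_le_apex_idx[of S y] idx_apex[of S] apex_in[of S] by fastforce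

lemma apex_idx_mono: "S \<in> P \<Longrightarrow> T \<in> P \<Longrightarrow> S \<subseteq> T \<Longrightarrow> apex_idx S \<le> apex_idx T"
  using apex_in idx_apex idx_le_apex_idx by (metis subsetD)

text \<open>Indices embed the clique into an initial segment. This bound prevents the subtraction in
  \<open>clique_rank\<close> from truncating.\<close>

lemma card_le_apex_idx:
  assumes "S \<in> P"
  shows "card S \<le> apex_idx S + 1"
proof -
  have "card S = card (idx ` S)"
    using inj_on_subset[OF idx_inj P_D(1)[OF assms]] by (simp add: card_image)
  also have "\<dots> \<le> card {..apex_idx S}"
    using idx_le_apex_idx[OF assms] by (intro card_mono) auto
  finally show ?thesis by simp
qed

lemma card_pos: "S \<in> P \<Longrightarrow> 0 < card S"
  using P_D by (simp add: card_gt_0_iff)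

lemma clique_rank_less:
  assumes "S \<in> P" "apex_idx S < apex_idx T"
  shows "clique_rank S < clique_rank T"
proof -
  \<comment> \<open>Ranks with apex index \<open>k\<close> form a block starting at
    \<open>k * (k + 2)\<close>. The offset is at most \<open>2 * k + 2\<close>, one short of the
    start \<open>(k + 1) * (k + 3)\<close> of the next block.\<close>
  have "clique_rank S < (apex_idx S + 1) * (apex_idx S + 3)"
    using card_le_apex_idx[OF assms(1)] unfolding clique_rank_def
    by (simp add: algebra_simps) linarith
  also have "\<dots> \<le> apex_idx T * (apex_idx T + 2)"
    using assms(2) by (intro mult_le_mono) auto
  also have "\<dots> \<le> clique_rank T" by (simp add: clique_rank_def)
  finally show ?thesis .
qed

lemma apex_idx_0: "S \<in> P \<Longrightarrow> apex_idx S = 0 \<Longrightarrow> S = {inv_into X idx 0} \<and> clique_rank S = 0"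
proof -
  assume S: "S \<in> P" "apex_idx S = 0"
  then have "x = inv_into X idx 0" if "x \<in> S" for x
    using that idx_le_apex_idx[OF S(1) that] idx_eq_apex_idx[OF S(1) that] by (simp add: apex_def)
  then have 1: "S = {inv_into X idx 0}" using P_D(3)[OF S(1)] by auto
  have "h (apex S) = apex S"
    using S idx_apex[OF S(1)] apex_in[OF S(1)] P_D(1)[OF S(1)] by (intro h_0) auto
  then show ?thesis using 1 S(2) apex_in[OF S(1)] by (auto simp: clique_rank_def)
qed

lemma apex_idx_pos: "S \<in> P \<Longrightarrow> 0 < clique_rank S \<Longrightarrow> 0 < apex_idx S"
  using apex_idx_0 by fastforce

lemma clique_rank_0: "S \<in> P \<Longrightarrow> clique_rank S = 0 \<Longrightarrow> S = {inv_into X idx 0}"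
  using apex_idx_0[of S] by (auto simp: clique_rank_def)

lemma h_apex:
  assumes "S \<in> P" "0 < clique_rank S"
  shows "h (apex S) \<in> X" "idx (h (apex S)) < apex_idx S" "h (apex S) \<noteq> apex S"
    "\<And>x. x \<in> S \<Longrightarrow> d (h (apex S)) x \<le> t"
proof -
  note S = assms(1) and apex = apex_in[OF assms(1)] idx_apex[OF assms(1)]
  have X: "apex S \<in> X" using P_D(1)[OF S] apex by auto
  then show "h (apex S) \<in> X" by (rule h_in)
  show less: "idx (h (apex S)) < apex_idx S"
    using idx_h[OF X] apex_idx_pos[OF assms] apex by simp
  then show "h (apex S) \<noteq> apex S" using apex by auto
  show "d (h (apex S)) x \<le> t" if "x \<in> S" for x
    using h_dominates[OF X, of x] P_D[OF S] apex idx_le_apex_idx[OF S] that by auto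
qed

lemma clique_step_P:
  assumes "S \<in> P" "0 < clique_rank S"
  shows "clique_step S \<in> P"
proof (cases "h (apex S) \<in> S")
  case True
  then have "S - {apex S} \<noteq> {}" using h_apex[OF assms] by auto
  then show ?thesis using True P_D[OF assms(1)] by (auto simp: clique_step_def vr_poset_def)
next
  case False
  have "d x (h (apex S)) \<le> t" if "x \<in> S" for x
    using h_apex[OF assms] that d_sym[of x "h (apex S)"] P_D(1)[OF assms(1)] by auto
  then show ?thesis
    using False P_D[OF assms(1)] h_apex[OF assms] d_refl by (auto simp: clique_step_def vr_poset_def)
qed

text \<open>Deleting the apex drops to an earlier block; adding \<open>h (apex S)\<close> keeps the
  apex and passes from the upper to the lower half of the same block.\<close>

lemma clique_rank_step_less:
  assumes "S \<in> P" "0 < clique_rank S"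
  shows "clique_rank (clique_step S) < clique_rank S"
proof (cases "h (apex S) \<in> S")
  case True
  have step: "clique_step S = S - {apex S}" using True by (simp add: clique_step_def)
  have "idx x < apex_idx S" if "x \<in> S - {apex S}" for x
    using that idx_le_apex_idx[OF assms(1), of x] idx_eq_apex_idx[OF assms(1), of x] by fastforce
  then have "apex_idx (clique_step S) < apex_idx S"
    using apex_in[OF clique_step_P[OF assms]] idx_apex[OF clique_step_P[OF assms]] step by metis
  then show ?thesis by (rule clique_rank_less[OF clique_step_P[OF assms]])
next
  case False
  have step: "clique_step S = insert (h (apex S)) S" using False by (simp add: clique_step_def)
  have "apex_idx (clique_step S) = idx (apex S)"
    using h_apex(2)[OF assms] idx_apex[OF assms(1)] idx_le_apex_idx[OF assms(1)] apex_in[OF assms(1)]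
    by (intro apex_idx_eqI[OF clique_step_P[OF assms]]) (auto simp: step)
  then have "apex_idx (clique_step S) = apex_idx S" using idx_apex[OF assms(1)] by simp
  then show ?thesis
    using False card_pos[OF assms(1)] by (simp add: clique_rank_def step apex_def)
qed

text \<open>Equal ranks force the same block, the same half and the same size, and nested finite
  sets of equal size coincide.\<close>

lemma clique_rank_inj:
  assumes "S \<in> P" "T \<in> P" "S \<subseteq> T" "clique_rank S = clique_rank T"
  shows "S = T"
proof -
  have m: "apex_idx S = apex_idx T"
    using clique_rank_less[OF assms(1), of T] clique_rank_less[OF assms(2), of S] assms(4) by linarith
  then have apex: "apex S = apex T" by (simp add: apex_def)
  have "card S = card T"
    using assms(4) m card_pos[OF assms(1)] card_le_apex_idx[OF assms(1)] card_le_apex_idx[OF assms(2)] assms(3)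
    by (auto simp: clique_rank_def apex split: if_splits)
  then show ?thesis using assms P_D(2) by (simp add: card_subset_eq)
qed

text \<open>The order inside a block is chosen for this. A clique \<open>T\<close> violating
  comparability would be a proper subset of \<open>S\<close> still containing the apex, or a proper
  superset still missing \<open>h (apex S)\<close>; either one ranks above \<open>S\<close>.\<close>

lemma clique_step_comparable:
  assumes S: "S \<in> P" "0 < clique_rank S" and T: "T \<in> P" "S \<subseteq> T \<or> T \<subseteq> S"
    and le: "clique_rank T \<le> clique_rank S"
  shows "clique_step S \<subseteq> T \<or> T \<subseteq> clique_step S"
proof -
  have mle: "apex_idx T \<le> apex_idx S"
    using clique_rank_less[OF S(1), of T] le by linarith
  have card: "card A < card B" if "A \<subset> B" "B \<in> P" for A B
    using that P_D(2) by (simp add: psubset_card_mono)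
  show ?thesis
  proof (cases "h (apex S) \<in> S")
    case True
    then have step: "clique_step S = S - {apex S}" by (simp add: clique_step_def)
    show ?thesis
    proof (rule ccontr)
      assume n: "\<not> ?thesis"
      then have TS: "T \<subset> S" "apex S \<in> T" using T(2) step by auto
      have "apex_idx T = apex_idx S"
        using mle idx_le_apex_idx[OF T(1) TS(2)] idx_apex[OF S(1)] by simp
      then show False
        using le True card[OF TS(1) S(1)] card_le_apex_idx[OF S(1)]
        by (auto simp: clique_rank_def apex_def split: if_splits)
    qed
  next
    case False
    then have step: "clique_step S = insert (h (apex S)) S" by (simp add: clique_step_def)
    show ?thesis
    proof (rule ccontr)
      assume n: "\<not> ?thesis"
      then have ST: "S \<subset> T" "h (apex S) \<notin> T" using T(2) step by auto
      have "apex_idx T = apex_idx S"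
        using mle apex_idx_mono[OF S(1) T(1)] ST by simp
      then show False
        using le False ST(2) card[OF ST(1) T(1)]
        by (auto simp: clique_rank_def apex_def split: if_splits)
    qed
  qed
qed

text \<open>Vertices are now cliques and simplices are chains. The step of the highest-ranked clique
  is comparable with every member of the chain, which yields \<open>cone\<close>.\<close>

sublocale ranked_collapse "order_complex P" clique_rank clique_step "{inv_into X idx 0}"
proof
  fix \<sigma> assume \<sigma>: "\<sigma> \<in> order_complex P"
  then have chain: "\<sigma> \<subseteq> P" "finite \<sigma>" "\<sigma> \<noteq> {}" "\<And>S T. S \<in> \<sigma> \<Longrightarrow> T \<in> \<sigma> \<Longrightarrow> S \<subseteq> T \<or> T \<subseteq> S"
    by (auto simp: order_complex_def chain_subset_def)
  show "finite \<sigma>" "\<sigma> \<noteq> {}" by fact+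
  show "\<tau> \<in> order_complex P" if "\<tau> \<subseteq> \<sigma>" "\<tau> \<noteq> {}" for \<tau>
    using that chain finite_subset[of \<tau> \<sigma>] unfolding order_complex_def chain_subset_def mem_Collect_eq
    by blast
  show "inj_on clique_rank \<sigma>"
    using chain clique_rank_inj by (intro inj_onI) (metis subsetD)
  fix S assume S: "S \<in> \<sigma>"
  then have SP: "S \<in> P" using chain by auto
  show "S = {inv_into X idx 0}" if "clique_rank S = 0"
    using clique_rank_0[OF SP that] .
  assume pos: "0 < clique_rank S"
  show "clique_rank (clique_step S) < clique_rank S"
    using clique_rank_step_less[OF SP pos] .
  assume max: "\<And>T. T \<in> \<sigma> \<Longrightarrow> clique_rank T \<le> clique_rank S"
  have "clique_step S \<subseteq> T \<or> T \<subseteq> clique_step S" if "T \<in> \<sigma>" for T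
    using chain S that max by (intro clique_step_comparable[OF SP pos]) auto
  then show "insert (clique_step S) \<sigma> \<in> order_complex P"
    using chain clique_step_P[OF SP pos] unfolding order_complex_def chain_subset_def
    by simp blast
qed

end

theorem contractible_vietoris_rips_dismantlable:
  fixes idx :: "'g \<Rightarrow> nat"
  assumes inj: "inj_on idx X"
    and sym: "\<And>x y. x \<in> X \<Longrightarrow> y \<in> X \<Longrightarrow> d x y = d y x"
    and refl: "\<And>x. x \<in> X \<Longrightarrow> d x x \<le> t"
    and dom: "\<And>x. x \<in> X \<Longrightarrow> 0 < idx x \<Longrightarrow>
      \<exists>y\<in>X. idx y < idx x \<and> (\<forall>z\<in>X. idx z \<le> idx x \<longrightarrow> d x z \<le> t \<longrightarrow> d y z \<le> t)"
  shows "contractible_space (vietoris_rips X d t)"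
proof -
  \<comment> \<open>Collects the requirements on a dominating vertex, with the convention at index
    0, so that one choice per element defines \<open>h\<close>.\<close>
  define good where "good x y \<longleftrightarrow> y \<in> X \<and> (0 < idx x \<longrightarrow> idx y < idx x) \<and> (idx x = 0 \<longrightarrow> y = x)
      \<and> (\<forall>z\<in>X. idx z \<le> idx x \<longrightarrow> d x z \<le> t \<longrightarrow> d y z \<le> t)" for x y
  define h where "h x = (SOME y. good x y)" for x
  have "\<exists>y. good x y" if "x \<in> X" for x
    using dom[OF that] that unfolding good_def by (cases "idx x = 0") auto
  then have good: "good x (h x)" if "x \<in> X" for x
    unfolding h_def using that by (blast intro: someI_ex)
  interpret dismantling X d t idx h
  proof
    show "d x y = d y x" if "x \<in> X" "y \<in> X" for x y
      using that by (rule sym)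
  qed (use good inj refl in \<open>auto simp: good_def\<close>)
  show ?thesis
    unfolding vietoris_rips_def by (rule contractible_geometric_realization)
qed

section \<open>Enumeration by increasing length\<close>

lemma finite_balls_enumeration:
  fixes L :: "'g \<Rightarrow> nat"
  assumes fin: "\<And>n. finite {x \<in> X. L x \<le> n}"
  obtains idx :: "'g \<Rightarrow> nat" where "inj_on idx X"
    "\<And>x y. x \<in> X \<Longrightarrow> y \<in> X \<Longrightarrow> L x < L y \<Longrightarrow> idx x < idx y"
    "\<And>x. x \<in> X \<Longrightarrow> 0 < idx x \<Longrightarrow> \<exists>y\<in>X. idx y < idx x"
proof -
  have "X = (\<Union>n. {x \<in> X. L x \<le> n})" by auto
  then have "countable X"
    using countable_UN[of UNIV "\<lambda>n. {x \<in> X. L x \<le> n}"] countable_finite[OF fin] by simp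
  then obtain e :: "'g \<Rightarrow> nat" where e: "inj_on e X"
    by (auto simp: countable_def)
  \<comment> \<open>Lengths are compared first and ties broken by the injection \<open>e\<close>.
    Finite balls make every set of predecessors finite, and its size is the index.\<close>
  define before where "before x = {y \<in> X. L y < L x \<or> L y = L x \<and> e y < e x}" for x
  have mono: "card (before y) < card (before x)" if "y \<in> before x" for x y
  proof (rule psubset_card_mono)
    show "finite (before x)"
      by (rule finite_subset[OF _ fin[of "L x"]]) (auto simp: before_def)
    show "before y \<subset> before x"
      using that by (auto simp: before_def)
  qed
  show ?thesis
  proof (rule that[of "\<lambda>x. card (before x)"])
    show "inj_on (\<lambda>x. card (before x)) X"
    proof (rule inj_onI, rule ccontr)
      fix x y assume xy: "x \<in> X" "y \<in> X" "card (before x) = card (before y)" "x \<noteq> y"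
      then have "e x \<noteq> e y" using e by (auto simp: inj_on_def)
      then have "x \<in> before y \<or> y \<in> before x" using xy by (auto simp: before_def)
      then show False using mono[of x y] mono[of y x] xy by auto
    qed
    show "card (before x) < card (before y)" if "x \<in> X" "L x < L y" for x y
      using that by (intro mono) (simp add: before_def)
    fix x assume "0 < card (before x)"
    then obtain y where "y \<in> before x" by (auto simp: card_gt_0_iff)
    then show "\<exists>y\<in>X. card (before y) < card (before x)"
      using mono[of y x] by (auto simp: before_def)
  qed
qed


section \<open>Normal forms in right-angled Artin groups\<close>

text \<open>Pilings: every vertex \<open>u\<close> carries a stack, and the letter \<open>(x, b)\<close> puts \<open>Some b\<close> on the stack of
  \<open>x\<close> and a blocking \<open>None\<close> on the stacks of the vertices that do not commute with \<open>x\<close>. The letters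
  that a reduced word can end in are the tops of the stacks that are not blocked.\<close>

type_synonym 'a piling = "'a \<Rightarrow> bool option list"

text \<open>An empty stack and a blocked one both give \<open>None\<close>: neither offers a letter
  to cancel.\<close>

definition stack_top :: "'a piling \<Rightarrow> 'a \<Rightarrow> bool option" where
  "stack_top p u = (if p u = [] then None else hd (p u))"

locale raag_graph =
  fixes V :: "'a set" and E :: "'a set set"
  assumes graph: "simplicial_graph V E"
begin

lemma not_edge_self: "{x} \<notin> E"
  using graph by (auto simp: simplicial_graph_def)

lemma edge_vertices: "{x, y} \<in> E \<Longrightarrow> x \<in> V \<and> y \<in> V"
  using graph by (auto simp: simplicial_graph_def)

lemma edge_commute: "{x, y} \<in> E \<longleftrightarrow> {y, x} \<in> E"
  by (simp add: insert_commute)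

abbreviation "W \<equiv> gwords V"
abbreviation eqv :: "'a gword \<Rightarrow> 'a gword \<Rightarrow> bool" (infix "\<simeq>" 50) where
  "u \<simeq> v \<equiv> (u, v) \<in> pres_cong V (raag_relations E)"

lemma W_simps [simp]:
  "[] \<in> W" "a # u \<in> W \<longleftrightarrow> fst a \<in> V \<and> u \<in> W" "u @ v \<in> W \<longleftrightarrow> u \<in> W \<and> v \<in> W"
  by (auto simp: gwords_def mem_Times_iff)

section \<open>Word congruence and commuting inverses\<close>

lemma eqv_context: "v \<simeq> v' \<Longrightarrow> u \<in> W \<Longrightarrow> w \<in> W \<Longrightarrow> u @ v @ w \<simeq> u @ v' @ w"
  by (intro pres_cong.mult pres_cong.refl)

lemma eqv_append: "u \<simeq> v \<Longrightarrow> w \<in> W \<Longrightarrow> u @ w \<simeq> v @ w"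
  by (intro pres_cong.mult pres_cong.refl)

lemma eqv_cancel: "x \<in> V \<Longrightarrow> [(x, \<not> b), (x, b)] \<simeq> []"
  using pres_cong.cancel[where b = "\<not> b"] by simp

text \<open>Writing X for the inverse of x: Xy = XyxX = XxyX = yX. The defining relations only
  mention positive letters, so this is applied in each position to reach all signs.\<close>

lemma eqv_swap_inverse:
  assumes xy: "x \<in> V" "y \<in> V" and swap: "[(x, b), (y, c)] \<simeq> [(y, c), (x, b)]"
  shows "[(x, \<not> b), (y, c)] \<simeq> [(y, c), (x, \<not> b)]"
proof -
  have "[(x, \<not> b), (y, c), (x, b), (x, \<not> b)] \<simeq> [(x, \<not> b), (y, c)]"
    using eqv_context[OF pres_cong.cancel[OF xy(1), of b], of "[(x, \<not> b), (y, c)]" "[]"] xy by simp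
  moreover have "[(x, \<not> b), (x, b), (y, c), (x, \<not> b)] \<simeq> [(x, \<not> b), (y, c), (x, b), (x, \<not> b)]"
    using eqv_context[OF swap, of "[(x, \<not> b)]" "[(x, \<not> b)]"] xy by simp
  moreover have "[(x, \<not> b), (x, b), (y, c), (x, \<not> b)] \<simeq> [(y, c), (x, \<not> b)]"
    using eqv_context[OF eqv_cancel[OF xy(1), of b], of "[]" "[(y, c), (x, \<not> b)]"] xy by simp
  ultimately show ?thesis
    by (blast intro: pres_cong.sym pres_cong.trans)
qed

lemma eqv_swap:
  assumes "{x, y} \<in> E"
  shows "[(x, b), (y, c)] \<simeq> [(y, c), (x, b)]"
proof -
  have xy: "x \<in> V" "y \<in> V" using edge_vertices[OF assms] by auto
  have T: "[(x, True), (y, True)] \<simeq> [(y, True), (x, True)]"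
    by (rule pres_cong.rel) (use assms xy in \<open>auto simp: raag_relations_def\<close>)
  have x: "[(x, b), (y, True)] \<simeq> [(y, True), (x, b)]" for b
    using T eqv_swap_inverse[OF xy T] by (cases b) auto
  show ?thesis
    using x[of b] pres_cong.sym[OF eqv_swap_inverse[OF xy(2,1) pres_cong.sym[OF x[of b]]]]
    by (cases c) auto
qed

section \<open>Pilings of reduced words\<close>

definition push :: "'a \<times> bool \<Rightarrow> 'a piling \<Rightarrow> 'a piling" where
  "push a p = (\<lambda>u. if {u, fst a} \<in> E then p u
     else (if u = fst a then Some (snd a) else None) # p u)"

definition pop :: "'a \<Rightarrow> 'a piling \<Rightarrow> 'a piling" where
  "pop x p = (\<lambda>u. if {u, x} \<in> E then p u else tl (p u))"

lemma stack_top_push: "stack_top (push (x, b) p) u =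
    (if {u, x} \<in> E then stack_top p u else if u = x then Some b else None)"
  by (simp add: stack_top_def push_def)

lemma stack_top_pop: "{u, x} \<in> E \<Longrightarrow> stack_top (pop x p) u = stack_top p u"
  by (simp add: stack_top_def pop_def)

lemma push_commute:
  assumes "{x, y} \<in> E"
  shows "push (x, b) (push (y, c) p) = push (y, c) (push (x, b) p)"
  using assms edge_commute[of x y] by (auto simp: push_def fun_eq_iff)

lemma pop_commute: "pop x (pop y p) = pop y (pop x p)"
  by (auto simp: pop_def fun_eq_iff)

lemma pop_push: "pop x (push (x, b) p) = p"
  by (auto simp: push_def pop_def fun_eq_iff)

text \<open>The side condition admits only words in which no letter cancels against the piling built
  so far.\<close>

inductive piled :: "'a gword \<Rightarrow> 'a piling \<Rightarrow> bool" where
  Nil: "piled [] (\<lambda>_. [])"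
| snoc: "piled w p \<Longrightarrow> x \<in> V \<Longrightarrow> stack_top p x \<noteq> Some (\<not> b) \<Longrightarrow> piled (w @ [(x, b)]) (push (x, b) p)"

lemma piled_W: "piled w p \<Longrightarrow> w \<in> W"
  by (induction rule: piled.induct) auto

text \<open>The last letter of \<open>w\<close> is either the one on top of the stack of
  \<open>x\<close> or commutes with it, since otherwise it would have blocked that stack.
  Inductively the wanted letter moves to the end.\<close>

lemma piled_topE:
  assumes "piled w p" "stack_top p x = Some b"
  obtains w' q where "piled w' q" "p = push (x, b) q" "stack_top q x \<noteq> Some (\<not> b)" "x \<in> V"
    "w \<simeq> w' @ [(x, b)]" "length w = Suc (length w')"
proof -
  have "\<exists>w' q. piled w' q \<and> p = push (x, b) q \<and> stack_top q x \<noteq> Some (\<not> b) \<and> x \<in> V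
    \<and> w \<simeq> w' @ [(x, b)] \<and> length w = Suc (length w')"
    using assms
  proof (induction rule: piled.induct)
    case (snoc w p y c)
    show ?case
    proof (cases "x = y")
      case True
      then have "c = b" using snoc.prems by (simp add: stack_top_push not_edge_self)
      then show ?thesis
        using snoc.hyps True piled_W[OF snoc.hyps(1)]
        by (intro exI[of _ w] exI[of _ p]) (auto intro: pres_cong.refl)
    next
      case False
      then have xy: "{x, y} \<in> E" and top: "stack_top p x = Some b"
        using snoc.prems by (auto simp: stack_top_push split: if_splits)
      obtain w' q where q: "piled w' q" "p = push (x, b) q" "stack_top q x \<noteq> Some (\<not> b)" "x \<in> V"
        "w \<simeq> w' @ [(x, b)]" "length w = Suc (length w')"
        using snoc.IH[OF top] by blast
      have y: "stack_top q y = stack_top p y"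
        using q(2) xy edge_commute[of x y] by (simp add: stack_top_push)
      then have "piled (w' @ [(y, c)]) (push (y, c) q)"
        using q(1) snoc.hyps by (intro piled.snoc) auto
      moreover have "push (y, c) p = push (x, b) (push (y, c) q)"
        using q(2) push_commute[OF xy] by simp
      moreover have "stack_top (push (y, c) q) x \<noteq> Some (\<not> b)"
        using q(3) xy by (simp add: stack_top_push)
      moreover have "w @ [(y, c)] \<simeq> (w' @ [(y, c)]) @ [(x, b)]"
      proof -
        have "w @ [(y, c)] \<simeq> (w' @ [(x, b)]) @ [(y, c)]"
          using q(5) snoc.hyps by (intro eqv_append) auto
        also have "(w' @ [(x, b)]) @ [(y, c)] = w' @ [(x, b), (y, c)] @ []" by simp
        finally show ?thesis
          using eqv_context[OF eqv_swap[OF xy, of b c], of w' "[]"] piled_W[OF q(1)]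
          by (auto intro: pres_cong.trans)
      qed
      ultimately show ?thesis
        using q by (intro exI[of _ "w' @ [(y, c)]"] exI[of _ "push (y, c) q"]) auto
    qed
  qed (simp add: stack_top_def)
  then show ?thesis using that by blast
qed

section \<open>The action of words on pilings\<close>

text \<open>The second component counts the letters of the piling.\<close>

fun act :: "'a piling \<times> nat \<Rightarrow> 'a \<times> bool \<Rightarrow> 'a piling \<times> nat" where
  "act (p, k) (x, b) =
     (if stack_top p x = Some (\<not> b) then (pop x p, k - 1) else (push (x, b) p, Suc k))"

text \<open>Arbitrary families of stacks are too general: a push restores what a pop removed only if
  the removed entries were those of a single letter.\<close>

definition valid :: "'a piling \<times> nat \<Rightarrow> bool" where
  "valid s \<longleftrightarrow> (\<exists>w. piled w (fst s) \<and> snd s = length w)"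

lemma valid_topE:
  assumes "valid s" "stack_top (fst s) x = Some b"
  obtains q k where "valid (q, k)" "s = (push (x, b) q, Suc k)" "stack_top q x \<noteq> Some (\<not> b)" "x \<in> V"
proof -
  obtain p n where s: "s = (p, n)" by fastforce
  obtain w where w: "piled w p" "n = length w" using assms(1) s by (auto simp: valid_def)
  obtain w' q where "piled w' q" "p = push (x, b) q" "stack_top q x \<noteq> Some (\<not> b)" "x \<in> V"
    "length w = Suc (length w')"
    using piled_topE[OF w(1), of x b] assms(2) s by (metis fst_conv)
  then show ?thesis
    using w s by (intro that[of q "length w'"]) (auto simp: valid_def)
qed

lemma valid_act:
  assumes "valid s" "fst a \<in> V"
  shows "valid (act s a)"
proof -
  obtain x b where a: "a = (x, b)" by fastforce
  obtain p n where s: "s = (p, n)" by fastforce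
  show ?thesis
  proof (cases "stack_top p x = Some (\<not> b)")
    case True
    then obtain q k where "valid (q, k)" "s = (push (x, \<not> b) q, Suc k)"
      using valid_topE[OF assms(1), of x "\<not> b"] s by (metis fst_conv)
    then show ?thesis using True s a by (auto simp: pop_push)
  next
    case False
    then show ?thesis
      using assms s a piled.snoc[of _ p x b] by (fastforce simp: valid_def)
  qed
qed

lemma act_cancel:
  assumes "valid s" "x \<in> V"
  shows "act (act s (x, b)) (x, \<not> b) = s"
proof -
  obtain p n where s: "s = (p, n)" by fastforce
  show ?thesis
  proof (cases "stack_top p x = Some (\<not> b)")
    case True
    \<comment> \<open>The condition on \<open>q\<close> makes the second letter push again instead
      of popping once more.\<close>
    then obtain q k where "s = (push (x, \<not> b) q, Suc k)" "stack_top q x \<noteq> Some b"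
      using valid_topE[OF assms(1), of x "\<not> b"] s by (metis fst_conv)
    then show ?thesis using True s by (auto simp: pop_push)
  next
    case False
    then show ?thesis using s by (auto simp: pop_push stack_top_push not_edge_self)
  qed
qed

text \<open>Both letters may touch the stack of a third vertex. Validity exhibits the popped entry
  there as a blocker, identical to the pushed one, so the order does not matter.\<close>

lemma act_commute_pop_push:
  assumes s: "valid (p, n)" and xy: "{x, y} \<in> E"
    and x: "stack_top p x = Some (\<not> b)" and y: "stack_top p y \<noteq> Some (\<not> c)"
  shows "act (act (p, n) (x, b)) (y, c) = act (act (p, n) (y, c)) (x, b)"
proof -
  obtain q k where q: "p = push (x, \<not> b) q" "n = Suc k"
    using valid_topE[OF s, of x "\<not> b"] x by (metis fst_conv snd_conv)
  have yx: "{y, x} \<in> E" using xy edge_commute by blast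
  have "stack_top q y \<noteq> Some (\<not> c)" using y q(1) yx by (simp add: stack_top_push)
  moreover have "stack_top (push (y, c) p) x = Some (\<not> b)" using x xy by (simp add: stack_top_push)
  ultimately show ?thesis
    using x y q push_commute[OF xy, of "\<not> b" c q, symmetric] by (simp add: pop_push)
qed

lemma act_commute:
  assumes "valid s" and xy: "{x, y} \<in> E"
  shows "act (act s (x, b)) (y, c) = act (act s (y, c)) (x, b)"
proof -
  obtain p n where s: "s = (p, n)" by fastforce
  have yx: "{y, x} \<in> E" using xy edge_commute by blast
  consider "stack_top p x = Some (\<not> b)" "stack_top p y = Some (\<not> c)"
    | "stack_top p x = Some (\<not> b)" "stack_top p y \<noteq> Some (\<not> c)"
    | "stack_top p x \<noteq> Some (\<not> b)" "stack_top p y = Some (\<not> c)"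
    | "stack_top p x \<noteq> Some (\<not> b)" "stack_top p y \<noteq> Some (\<not> c)" by blast
  then show ?thesis
  proof cases
    case 1
    then show ?thesis using s xy yx by (simp add: stack_top_pop pop_commute[of x y])
  next
    case 2
    then show ?thesis using act_commute_pop_push[of p n x y b c] assms s by simp
  next
    case 3
    then show ?thesis using act_commute_pop_push[of p n y x c b] assms s yx by simp
  next
    case 4
    then show ?thesis using s xy yx push_commute[OF xy] by (simp add: stack_top_push)
  qed
qed

abbreviation "run \<equiv> foldl act"

lemma valid_run: "valid s \<Longrightarrow> u \<in> W \<Longrightarrow> valid (run s u)"
  by (induction u arbitrary: s) (simp_all add: valid_act)

text \<open>The action respects cancellation and commutation, hence the whole congruence; so piling
  and length are invariants of the group element.\<close>

lemma run_eqv: "u \<simeq> v \<Longrightarrow> valid s \<Longrightarrow> run s u = run s v"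
proof (induction arbitrary: s rule: pres_cong.induct)
  case (mult u u' v v')
  then show ?case
    using valid_run pres_cong_gwords[OF mult.hyps(1)] by simp
next
  case (cancel x b)
  then show ?case by (simp add: act_cancel)
next
  case (rel u v)
  then obtain x y where "u = [(x, True), (y, True)]" "v = [(y, True), (x, True)]" "{x, y} \<in> E"
    by (auto simp: raag_relations_def)
  then show ?case using act_commute[OF rel.prems] by simp
qed auto

section \<open>Reduced representatives\<close>

definition piling :: "'a gword \<Rightarrow> 'a piling" where
  "piling u = fst (run (\<lambda>_. [], 0) u)"

definition len :: "'a gword \<Rightarrow> nat" where
  "len u = snd (run (\<lambda>_. [], 0) u)"

lemma run_init: "run (\<lambda>_. [], 0) u = (piling u, len u)"
  by (simp add: piling_def len_def)

lemma valid_init: "valid (\<lambda>_. [], 0)"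
  using piled.Nil by (auto simp: valid_def)

lemma valid_piling: "u \<in> W \<Longrightarrow> valid (piling u, len u)"
  using valid_run[OF valid_init] by (simp add: run_init)

lemma act_piling: "act (piling u, len u) a = (piling (u @ [a]), len (u @ [a]))"
  by (simp add: piling_def len_def)

lemma len_eqv: "u \<simeq> v \<Longrightarrow> len u = len v"
  using run_eqv[OF _ valid_init] by (simp add: len_def)

lemma len_Nil [simp]: "len [] = 0"
  by (simp add: len_def)

lemma len_le_length: "len u \<le> length u"
proof (induction u rule: rev_induct)
  case (snoc a u)
  then show ?case
    using act_piling[of u a] by (cases a) (auto split: if_splits)
qed simp

text \<open>An appended letter either extends the reduced word or cancels a letter that
  \<open>piled_topE\<close> first brings to its end.\<close>

lemma reduced_word_exists:
  assumes "u \<in> W"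
  shows "\<exists>w. piled w (piling u) \<and> length w = len u \<and> w \<simeq> u"
  using assms
proof (induction u rule: rev_induct)
  case Nil
  then show ?case
    using piled.Nil by (auto simp: piling_def intro: pres_cong.refl)
next
  case (snoc a u)
  obtain x b where a: "a = (x, b)" by fastforce
  have x: "x \<in> V" "u \<in> W" using snoc.prems a by auto
  obtain w where w: "piled w (piling u)" "length w = len u" "w \<simeq> u"
    using snoc.IH x(2) by blast
  have wu: "w @ [a] \<simeq> u @ [a]" using w(3) x a by (intro eqv_append) auto
  show ?case
  proof (cases "stack_top (piling u) x = Some (\<not> b)")
    case True
    then obtain w' q where q: "piled w' q" "piling u = push (x, \<not> b) q" "w \<simeq> w' @ [(x, \<not> b)]"
      "length w = Suc (length w')"
      using piled_topE[OF w(1)] by metis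
    have "piling (u @ [a]) = q" "len (u @ [a]) = length w'"
      using act_piling[of u a] True a q w(2) by (auto simp: pop_push)
    moreover have "w' \<simeq> u @ [a]"
    proof -
      have "w @ [a] \<simeq> w' @ [(x, \<not> b), (x, b)]"
        using eqv_append[OF q(3), of "[a]"] x a by simp
      moreover have "w' @ [(x, \<not> b), (x, b)] \<simeq> w'"
        using eqv_context[OF eqv_cancel[OF x(1), of b], of w' "[]"] piled_W[OF q(1)] by simp
      ultimately have "w @ [a] \<simeq> w'" by (rule pres_cong.trans)
      then show ?thesis
        using wu by (rule pres_cong.trans[OF pres_cong.sym])
    qed
    ultimately show ?thesis using q(1) by (intro exI[of _ w']) simp
  next
    case False
    then have "piling (u @ [a]) = push a (piling u)" "len (u @ [a]) = Suc (len u)"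
      using act_piling[of u a] a by auto
    then show ?thesis
      using piled.snoc[OF w(1) x(1) False] w(2) wu a by (intro exI[of _ "w @ [a]"]) auto
  qed
qed

section \<open>Descents and common shortenings\<close>

text \<open>The letters whose appending shortens the element: their inverses are the possible last
  letters of reduced words.\<close>

definition descent :: "'a gword \<Rightarrow> 'a \<times> bool \<Rightarrow> bool" where
  "descent u a \<longleftrightarrow> stack_top (piling u) (fst a) = Some (\<not> snd a)"

lemma descent_iff: "descent u a \<longleftrightarrow> len (u @ [a]) \<le> len u"
  using act_piling[of u a] by (cases a) (auto simp: descent_def split: if_splits)

text \<open>All claims follow by writing the piling as a push of the inverse of \<open>a\<close>.
  That push blocks every stack not adjacent to \<open>fst a\<close> and fixes the sign at
  \<open>fst a\<close> itself, while adjacent stacks are untouched.\<close>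

lemma
  assumes "u \<in> W" "descent u a"
  shows descent_V: "fst a \<in> V" and len_descent: "len u = Suc (len (u @ [a]))"
    and descent_edge: "descent u b \<Longrightarrow> b \<noteq> a \<Longrightarrow> {fst a, fst b} \<in> E"
    and descent_after: "{fst b, fst a} \<in> E \<Longrightarrow> descent u b \<Longrightarrow> descent (u @ [a]) b"
proof -
  obtain q k where q: "(piling u, len u) = (push (fst a, \<not> snd a) q, Suc k)" "fst a \<in> V"
    using valid_topE[OF valid_piling[OF assms(1)], of "fst a" "\<not> snd a"] assms(2)
    by (metis descent_def fst_conv)
  show "fst a \<in> V" by fact
  have "act (piling u, len u) a = (q, k)"
    using assms(2) q(1) by (cases a) (auto simp: descent_def pop_push)
  then have eq: "piling (u @ [a]) = q" "len (u @ [a]) = k" by (simp_all add: act_piling)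
  then show "len u = Suc (len (u @ [a]))" using q by simp
  show "{fst a, fst b} \<in> E" if "descent u b" "b \<noteq> a"
    using that assms(2) q(1) edge_commute[of "fst a" "fst b"]
    by (auto simp: descent_def stack_top_push prod_eq_iff split: if_splits)
  show "descent (u @ [a]) b" if "{fst b, fst a} \<in> E" "descent u b"
    using that q(1) eq by (auto simp: descent_def stack_top_push)
qed

lemma descent_exists:
  assumes "u \<in> W" "0 < len u"
  obtains a where "descent u a"
proof -
  obtain w where "piled w (piling u)" "length w = len u"
    using reduced_word_exists[OF assms(1)] by blast
  then show ?thesis
  proof cases
    case (snoc w' p x b)
    then have "descent u (x, \<not> b)" by (simp add: descent_def stack_top_push not_edge_self)
    then show ?thesis by (rule that)
  qed (use assms in simp)
qed

text \<open>If the first letter of \<open>w\<close> is not a descent, then the second one cancels a last letter of \<open>u\<close>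
  with which the first one commutes, so the two can be exchanged.\<close>

lemma short_word_descent:
  assumes "u \<in> W" "w \<in> W" "length w \<le> 2" "len (u @ w) \<le> len u" "\<not> w \<simeq> []"
  obtains a c where "descent u a" "c \<in> W" "length c \<le> 1" "w \<simeq> a # c"
proof -
  have "w \<noteq> []" using assms(5) by (auto intro: pres_cong.refl)
  then obtain a v where w: "w = a # v" by (cases w) auto
  show ?thesis
  proof (cases "descent u a")
    case True
    then show ?thesis
      using assms w by (intro that[of a v]) (auto intro: pres_cong.refl)
  next
    case False
    then have grow: "piling (u @ [a]) = push a (piling u)" "len (u @ [a]) = Suc (len u)"
      using act_piling[of u a] by (cases a; auto simp: descent_def)+
    have "v \<noteq> []" using grow assms(4) w by auto
    then obtain b where v: "v = [b]" using assms(3) w by (cases v) auto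
    have V: "fst a \<in> V" "fst b \<in> V" using assms(2) w v by auto
    have b: "descent (u @ [a]) b"
      unfolding descent_iff using grow assms(4) w v by simp
    \<comment> \<open>On the same vertex \<open>b\<close> would undo \<open>a\<close>, making
      \<open>w\<close> trivial.\<close>
    have "fst b \<noteq> fst a"
    proof
      assume eq: "fst b = fst a"
      then have "snd b = (\<not> snd a)"
        using b grow by (cases a) (auto simp: descent_def stack_top_push not_edge_self)
      then have "w \<simeq> []"
        using pres_cong.cancel[OF V(1), of "snd a"] eq w v by (cases a, cases b) auto
      with assms(5) show False ..
    qed
    then have ba: "{fst b, fst a} \<in> E" and desc: "descent u b"
      using b grow by (cases a; auto simp: descent_def stack_top_push split: if_splits)+
    have "w \<simeq> b # [a]"
      using eqv_swap[of "fst a" "fst b" "snd a" "snd b"] ba edge_commute[of "fst a" "fst b"] w v by simp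
    then show ?thesis using desc V by (intro that[of b "[a]"]) auto
  qed
qed

text \<open>Descents are pairwise adjacent, so there are one or two, and \<open>v\<close> cancels
  them all. As two descents commute, \<open>v\<close> is reached through either of them with one
  further letter.\<close>

lemma common_descent:
  assumes "triangle_free V E" "u \<in> W" "0 < len u"
  obtains v where "v \<in> W" "len v < len u"
    "\<And>a. descent u a \<Longrightarrow> \<exists>c\<in>W. length c \<le> 1 \<and> v \<simeq> u @ a # c"
proof -
  obtain a where a: "descent u a" using descent_exists[OF assms(2,3)] .
  note aV = descent_V[OF assms(2) a]
  show ?thesis
  proof (cases "\<exists>b. descent u b \<and> b \<noteq> a")
    case False
    show ?thesis
    proof (rule that[of "u @ [a]"])
      show "len (u @ [a]) < len u" using len_descent[OF assms(2) a] by simp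
      fix a' assume "descent u a'"
      then have "a' = a" using False by blast
      then show "\<exists>c\<in>W. length c \<le> 1 \<and> u @ [a] \<simeq> u @ a' # c"
        using aV assms(2) by (intro bexI[of _ "[]"]) (auto intro: pres_cong.refl)
    qed (use aV assms in simp)
  next
    case True
    then obtain b where b: "descent u b" "b \<noteq> a" by blast
    note bV = descent_V[OF assms(2) b(1)]
    have ab: "{fst a, fst b} \<in> E" using descent_edge[OF assms(2) a b] .
    have "descent (u @ [a]) b"
      using descent_after[OF assms(2) a _ b(1)] ab edge_commute by blast
    then have "len (u @ [a]) = Suc (len ((u @ [a]) @ [b]))"
      using assms(2) aV by (intro len_descent) auto
    then have less: "len (u @ [a, b]) < len u"
      using len_descent[OF assms(2) a] by simp
    have swap: "u @ [a, b] \<simeq> u @ [b, a]"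
      using eqv_context[OF eqv_swap[OF ab, of "snd a" "snd b"], of u "[]"] assms(2) by simp
    have only: "c = a \<or> c = b" if "descent u c" for c
    proof (rule ccontr)
      assume n: "\<not> ?thesis"
      then have "{fst a, fst c} \<in> E" "{fst b, fst c} \<in> E"
        using descent_edge[OF assms(2) a that] descent_edge[OF assms(2) b(1) that] by auto
      with ab assms(1) show False
        using edge_vertices unfolding triangle_free_def by blast
    qed
    show ?thesis
    proof (rule that[of "u @ [a, b]"])
      fix c assume "descent u c"
      then consider "c = a" | "c = b" using only by blast
      then show "\<exists>c'\<in>W. length c' \<le> 1 \<and> u @ [a, b] \<simeq> u @ c # c'"
      proof cases
        case 1
        then show ?thesis
          using assms(2) aV bV by (intro bexI[of _ "[b]"]) (auto intro: pres_cong.refl)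
      next
        case 2
        then show ?thesis
          using swap aV by (intro bexI[of _ "[a]"]) auto
      qed
    qed (use less assms(2) aV bV in auto)
  qed
qed

end


section \<open>Word lengths and the main theorem\<close>

context raag_graph
begin

abbreviation "G \<equiv> raag V E"
abbreviation "gens \<equiv> raag_gens V E"
abbreviation "cl u \<equiv> pres_cong V (raag_relations E) `` {u}"
abbreviation "L \<equiv> word_length G gens"
abbreviation "wdist \<equiv> word_metric G gens"

sublocale group G
  unfolding raag_def by (rule group_presented_group)

lemma cl_carrier [simp]: "u \<in> W \<Longrightarrow> cl u \<in> carrier G"
  unfolding raag_def by (rule pres_class_carrier)

lemma carrierE: "g \<in> carrier G \<Longrightarrow> (\<And>u. u \<in> W \<Longrightarrow> g = cl u \<Longrightarrow> thesis) \<Longrightarrow> thesis"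
  unfolding raag_def by (erule presented_carrierE)

lemma cl_mult: "u \<in> W \<Longrightarrow> v \<in> W \<Longrightarrow> cl u \<otimes>\<^bsub>G\<^esub> cl v = cl (u @ v)"
  unfolding raag_def by (rule pres_class_mult)

lemma cl_Nil: "cl [] = \<one>\<^bsub>G\<^esub>"
  unfolding raag_def by (simp add: presented_one)

lemma cl_eq_iff: "u \<in> W \<Longrightarrow> v \<in> W \<Longrightarrow> cl u = cl v \<longleftrightarrow> u \<simeq> v"
  by (rule eq_equiv_class_iff[OF equiv_pres_cong])

lemma cl_eq: "u \<simeq> v \<Longrightarrow> cl u = cl v"
  by (rule equiv_class_eq[OF equiv_pres_cong])

lemma cl_inv: "u \<in> W \<Longrightarrow> inv\<^bsub>G\<^esub> (cl u) = cl (gword_inv u)"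
  using cl_mult[of "gword_inv u" u] gword_inv_gwords[of u V] cl_eq[OF gword_inv_cong[of u V]]
  by (intro inv_equality) (simp_all add: cl_Nil)

lemma length_gword_inv: "length (gword_inv u) = length u"
  by (simp add: gword_inv_def)

section \<open>Word length and distance in the group\<close>

lemma letters: "gens \<union> m_inv G ` gens = (\<lambda>a. cl [a]) ` (V \<times> UNIV)"
proof -
  have gens: "gens = (\<lambda>x. cl [(x, True)]) ` V"
    by (simp add: raag_gens_def presented_gens_def)
  have "m_inv G ` gens = (\<lambda>x. cl [(x, False)]) ` V"
    unfolding gens image_image by (rule image_cong) (simp_all add: cl_inv gword_inv_def)
  moreover have "V \<times> (UNIV :: bool set) = (\<lambda>x. (x, True)) ` V \<union> (\<lambda>x. (x, False)) ` V"
    by (auto simp: UNIV_bool)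
  ultimately show ?thesis
    unfolding gens by (simp add: image_Un image_image)
qed

lemma foldr_letters: "u \<in> W \<Longrightarrow> foldr (mult G) (map (\<lambda>a. cl [a]) u) \<one>\<^bsub>G\<^esub> = cl u"
  by (induction u) (simp_all add: cl_Nil cl_mult)

text \<open>A reduced representative attains the value \<open>len u\<close>; any other representing
  word has the same \<open>len\<close>, which its length cannot undercut.\<close>

lemma L_cl:
  assumes "u \<in> W"
  shows "L (cl u) = len u"
  unfolding word_length_def letters
proof (rule Least_equality)
  obtain w where w: "piled w (piling u)" "length w = len u" "w \<simeq> u"
    using reduced_word_exists[OF assms] by blast
  then have "w \<in> W" by (auto dest: piled_W)
  then show "\<exists>xs. set xs \<subseteq> (\<lambda>a. cl [a]) ` (V \<times> UNIV) \<and> length xs = len u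
      \<and> foldr (mult G) xs \<one>\<^bsub>G\<^esub> = cl u"
    using w foldr_letters cl_eq[OF w(3)]
    by (intro exI[of _ "map (\<lambda>a. cl [a]) w"]) (auto simp: gwords_def)
next
  fix n assume "\<exists>xs. set xs \<subseteq> (\<lambda>a. cl [a]) ` (V \<times> UNIV) \<and> length xs = n
      \<and> foldr (mult G) xs \<one>\<^bsub>G\<^esub> = cl u"
  then obtain xs where xs: "xs \<in> lists ((\<lambda>a. cl [a]) ` (V \<times> UNIV))" "length xs = n"
    "foldr (mult G) xs \<one>\<^bsub>G\<^esub> = cl u" by (auto simp: in_lists_conv_set)
  then obtain w where w: "w \<in> W" "xs = map (\<lambda>a. cl [a]) w"
    unfolding lists_image gwords_def by auto
  then have "cl w = cl u" using xs foldr_letters by simp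
  then have "len u = len w" using len_eqv cl_eq_iff w(1) assms by metis
  then show "len u \<le> n" using len_le_length[of w] w xs by simp
qed

lemma L_le_length: "u \<in> W \<Longrightarrow> L (cl u) \<le> length u"
  by (simp add: L_cl len_le_length)

lemma shortest_wordE:
  assumes "g \<in> carrier G"
  obtains w where "w \<in> W" "g = cl w" "length w = L g"
proof -
  obtain u where u: "u \<in> W" "g = cl u" using assms by (rule carrierE)
  obtain w where "piled w (piling u)" "length w = len u" "w \<simeq> u"
    using reduced_word_exists[OF u(1)] by blast
  then show ?thesis
    using u piled_W cl_eq L_cl by (intro that[of w]) auto
qed

lemma L_inv: "g \<in> carrier G \<Longrightarrow> L (inv\<^bsub>G\<^esub> g) = L g"
proof -
  have le: "L (inv\<^bsub>G\<^esub> g) \<le> L g" if g: "g \<in> carrier G" for g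
  proof -
    obtain w where "w \<in> W" "g = cl w" "length w = L g" using shortest_wordE[OF g] .
    then show ?thesis
      using L_le_length[OF gword_inv_gwords[of w V]] by (simp add: cl_inv length_gword_inv)
  qed
  assume "g \<in> carrier G"
  then show ?thesis using le[of g] le[of "inv\<^bsub>G\<^esub> g"] by simp
qed

lemma L_eq_0: "g \<in> carrier G \<Longrightarrow> L g = 0 \<Longrightarrow> g = \<one>\<^bsub>G\<^esub>"
  by (erule shortest_wordE) (simp add: cl_Nil)

lemma dist_commute:
  assumes "g \<in> carrier G" "h \<in> carrier G"
  shows "wdist g h = wdist h g"
proof -
  have "inv\<^bsub>G\<^esub> (inv\<^bsub>G\<^esub> g \<otimes>\<^bsub>G\<^esub> h) = inv\<^bsub>G\<^esub> h \<otimes>\<^bsub>G\<^esub> g"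
    using assms by (simp add: inv_mult_group)
  then show ?thesis
    using L_inv[of "inv\<^bsub>G\<^esub> g \<otimes>\<^bsub>G\<^esub> h"] assms by (simp add: word_metric_def)
qed

lemma dist_self: "g \<in> carrier G \<Longrightarrow> wdist g g = 0"
  using L_le_length[of "[]"] by (simp add: word_metric_def l_inv cl_Nil)

text \<open>The prefix cancels in the quotient, leaving the inverse of \<open>v\<close> followed by
  \<open>w\<close>.\<close>

lemma dist_common_prefix:
  assumes "u \<in> W" "v \<in> W" "w \<in> W"
  shows "wdist (cl (u @ v)) (cl (u @ w)) \<le> real (length v + length w)"
proof -
  have "inv\<^bsub>G\<^esub> (cl (u @ v)) \<otimes>\<^bsub>G\<^esub> cl (u @ w)
      = (inv\<^bsub>G\<^esub> (cl v) \<otimes>\<^bsub>G\<^esub> inv\<^bsub>G\<^esub> (cl u)) \<otimes>\<^bsub>G\<^esub> (cl u \<otimes>\<^bsub>G\<^esub> cl w)"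
    using assms by (simp add: cl_mult[symmetric] inv_mult_group)
  also have "\<dots> = inv\<^bsub>G\<^esub> (cl v) \<otimes>\<^bsub>G\<^esub> cl w"
  proof -
    have "inv\<^bsub>G\<^esub> (cl u) \<otimes>\<^bsub>G\<^esub> (cl u \<otimes>\<^bsub>G\<^esub> cl w) = cl w"
      using assms by (simp add: m_assoc[symmetric])
    then show ?thesis using assms by (simp add: m_assoc)
  qed
  also have "\<dots> = cl (gword_inv v @ w)"
    using assms by (simp add: cl_inv cl_mult gword_inv_gwords)
  finally show ?thesis
    using L_le_length[of "gword_inv v @ w"] assms gword_inv_gwords[of v V]
    by (simp add: word_metric_def length_gword_inv)
qed

lemma finite_ball:
  assumes "finite V"
  shows "finite {g \<in> carrier G. L g \<le> n}"
proof (rule finite_surj)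
  show "finite {u. set u \<subseteq> V \<times> (UNIV :: bool set) \<and> length u \<le> n}"
    using assms by (intro finite_lists_length_le) simp
  show "{g \<in> carrier G. L g \<le> n} \<subseteq> (\<lambda>u. cl u) ` {u. set u \<subseteq> V \<times> UNIV \<and> length u \<le> n}"
  proof clarify
    fix g assume "g \<in> carrier G" and le: "L g \<le> n"
    then obtain w where "w \<in> W" "g = cl w" "length w = L g" by (elim shortest_wordE)
    then show "g \<in> (\<lambda>u. cl u) ` {u. set u \<subseteq> V \<times> UNIV \<and> length u \<le> n}"
      using le by (auto simp: gwords_def)
  qed
qed

section \<open>Domination in the group\<close>

lemma dominating_element:
  assumes "triangle_free V E" "g \<in> carrier G" "g \<noteq> \<one>\<^bsub>G\<^esub>"
  obtains h where "h \<in> carrier G" "L h < L g"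
    "\<And>z. z \<in> carrier G \<Longrightarrow> L z \<le> L g \<Longrightarrow> wdist g z \<le> 2 \<Longrightarrow> wdist h z \<le> 2"
proof -
  obtain u where u: "u \<in> W" "g = cl u" using carrierE[OF assms(2)] .
  have pos: "0 < len u" using L_eq_0[OF assms(2)] assms(3) u L_cl by auto
  obtain v where v: "v \<in> W" "len v < len u"
    and common: "\<And>a. descent u a \<Longrightarrow> \<exists>c\<in>W. length c \<le> 1 \<and> v \<simeq> u @ a # c"
    using common_descent[OF assms(1) u(1) pos] by metis
  show ?thesis
  proof (rule that[of "cl v"])
    show "L (cl v) < L g" using v u by (simp add: L_cl)
    fix z assume z: "z \<in> carrier G" "L z \<le> L g" "wdist g z \<le> 2"
    have "inv\<^bsub>G\<^esub> g \<otimes>\<^bsub>G\<^esub> z \<in> carrier G" using z assms(2) by simp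
    then obtain w where w: "w \<in> W" "inv\<^bsub>G\<^esub> g \<otimes>\<^bsub>G\<^esub> z = cl w" "length w \<le> 2"
      using z(3) by (elim shortest_wordE) (simp add: word_metric_def)
    have "z = g \<otimes>\<^bsub>G\<^esub> (inv\<^bsub>G\<^esub> g \<otimes>\<^bsub>G\<^esub> z)"
      using z assms(2) by (simp add: m_assoc[symmetric])
    then have zw: "z = cl (u @ w)" using w u by (simp add: cl_mult)
    show "wdist (cl v) z \<le> 2"
    proof (cases "w \<simeq> []")
      case True
      \<comment> \<open>Here \<open>z\<close> equals \<open>g\<close>, and any descent leads from it
        to \<open>v\<close> in at most two letters.\<close>
      obtain a where a: "descent u a" using descent_exists[OF u(1) pos] .
      obtain c where c: "c \<in> W" "length c \<le> 1" "v \<simeq> u @ a # c" using common[OF a] by blast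
      have "z = cl (u @ [])"
        using eqv_context[OF True u(1), of "[]"] zw cl_eq by fastforce
      then show ?thesis
        using dist_common_prefix[of u "a # c" "[]"] u c descent_V[OF u(1) a] cl_eq[OF c(3)] by simp
    next
      case False
      have "len (u @ w) \<le> len u" using z(2) zw u w by (simp add: L_cl)
      then obtain a c' where c': "descent u a" "c' \<in> W" "length c' \<le> 1" "w \<simeq> a # c'"
        using short_word_descent[OF u(1) w(1,3) _ False] by blast
      obtain c where c: "c \<in> W" "length c \<le> 1" "v \<simeq> u @ a # c" using common[OF c'(1)] by blast
      have "u @ w \<simeq> u @ a # c'"
        using eqv_context[OF c'(4) u(1), of "[]"] by simp
      then have "z = cl (u @ a # c')" using zw cl_eq by simp
      \<comment> \<open>Both elements extend \<open>u @ [a]\<close> by at most one letter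
        each.\<close>
      then show ?thesis
        using dist_common_prefix[of "u @ [a]" c c'] u c c' descent_V[OF u(1) c'(1)] cl_eq[OF c(3)]
        by simp
    qed
  qed (use v in simp)
qed

end

theorem theorem2:
  fixes V :: "'a set" and E :: "'a set set"
  assumes "simplicial_graph V E"
    and "finite V"
    and "triangle_free V E"
  shows "contractible_space (raag_vietoris_rips V E 2)"
proof -
  interpret raag_graph V E by unfold_locales fact
  obtain idx :: "'a gword set \<Rightarrow> nat" where idx: "inj_on idx (carrier G)"
    "\<And>x y. x \<in> carrier G \<Longrightarrow> y \<in> carrier G \<Longrightarrow> L x < L y \<Longrightarrow> idx x < idx y"
    "\<And>x. x \<in> carrier G \<Longrightarrow> 0 < idx x \<Longrightarrow> \<exists>y\<in>carrier G. idx y < idx x"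
    using finite_balls_enumeration[OF finite_ball[OF assms(2)]] by metis
  show ?thesis
    unfolding raag_vietoris_rips_def
  proof (rule contractible_vietoris_rips_dismantlable[OF idx(1)])
    fix g assume g: "g \<in> carrier G" "0 < idx g"
    \<comment> \<open>The identity has index 0: an element enumerated before it would also have
      length 0.\<close>
    have "g \<noteq> \<one>\<^bsub>G\<^esub>"
    proof
      assume one: "g = \<one>\<^bsub>G\<^esub>"
      obtain y where y: "y \<in> carrier G" "idx y < idx g" using idx(3)[OF g] by blast
      then have "L y = 0" using idx(2)[OF g(1) y(1)] L_le_length[of "[]"] one by (auto simp: cl_Nil)
      then show False using L_eq_0[OF y(1)] y(2) one by simp
    qed
    then obtain h where h: "h \<in> carrier G" "L h < L g"
      "\<And>z. z \<in> carrier G \<Longrightarrow> L z \<le> L g \<Longrightarrow> wdist g z \<le> 2 \<Longrightarrow> wdist h z \<le> 2"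
      using dominating_element[OF assms(3) g(1)] by metis
    \<comment> \<open>Elements enumerated no later than \<open>g\<close> lie in the ball where
      domination is known.\<close>
    have "L z \<le> L g" if "z \<in> carrier G" "idx z \<le> idx g" for z
      using idx(2)[OF g(1) that(1)] that(2) by (meson leD leI)
    then show "\<exists>h\<in>carrier G. idx h < idx g
        \<and> (\<forall>z\<in>carrier G. idx z \<le> idx g \<longrightarrow> wdist g z \<le> 2 \<longrightarrow> wdist h z \<le> 2)"
      using h idx(2)[OF h(1) g(1)] by (intro bexI[of _ h]) auto
  qed (simp_all add: dist_commute dist_self)
qed

end
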